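(* Let $n$ be a non-negative integer and let $$\Theta_1(n,0)=\sum_{k=1}^\infty \frac{\psi\left(\frac{2k+2n+5}{4}\right)-\psi\left(\frac{2k+2n+3}{4}\right)}{(2k)^2}.$$ Then: (i) if $n=0$: $\Theta_1(0,0)=-4+4\ln 2-\frac{\pi}{2}\ln^2 2+\frac{\pi^2}{6}-\frac{11\pi^3}{48}-4G\ln 2+8\,\Im(\mathrm{Li}_3(1+i))$; (ii) if $n=1$: $\Theta_1(1,0)=\frac{92}{27}-\frac{\pi^2}{9}-\frac{32\ln 2}{9}+\frac{\pi}{2}\ln^2 2+\frac{11\pi^3}{48}+4G\ln 2-8\,\Im(\mathrm{Li}_3(1+i))$; (iii) if $n$ is odd and $n\neq1$: $$\begin{aligned}\Theta_1(n,0)={}&\frac{92}{27}+16\sum_{j=1}^{\frac{n-1}{2}}\frac{(2j+1)(2H_{4j+1}-H_{2j})}{(4j+3)^2(4j+1)^2}-4\sum_{j=1}^{\frac{n-1}{2}}\frac{1}{(4j+3)^3}-\pi^2\left(\frac19+\frac13\sum_{j=1}^{\frac{n-1}{2}}\frac{1}{(4j+3)(4j+1)}\right)\\&-\ln 2\left(\frac{32}{9}+32\sum_{j=1}^{\frac{n-1}{2}}\frac{2j+1}{(4j+3)^2(4j+1)^2}\right)+\frac{\pi}{2}\ln^2 2+\frac{11\pi^3}{48}+4G\ln 2-8\,\Im(\mathrm{Li}_3(1+i));\end{aligned}$$ (iv) if $n$ is even: $$\begin{aligned}\Theta_1(n,0)={}&-4+32\sum_{j=0}^{\frac{n-2}{2}}\frac{(j+1)(2H_{4j+3}-H_{2j+1})}{(4j+5)^2(4j+3)^2}-4\sum_{j=0}^{\frac{n-2}{2}}\frac{1}{(4j+5)^3}+\pi^2\left(\frac16-\frac13\sum_{j=0}^{\frac{n-2}{2}}\frac{1}{(4j+5)(4j+3)}\right)\\&+\ln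 2\left(4-64\sum_{j=0}^{\frac{n-2}{2}}\frac{j+1}{(4j+5)^2(4j+3)^2}\right)-\frac{\pi}{2}\ln^2 2-\frac{11\pi^3}{48}-4G\ln 2+8\,\Im(\mathrm{Li}_3(1+i)).\end{aligned}$$
   Context: $\psi=\Gamma'/\Gamma$ is the digamma function, $H_n=\sum_{k=1}^n\frac1k$ the $n$-th harmonic number, $G=\sum_{k=0}^\infty\frac{(-1)^k}{(2k+1)^2}$ is Catalan's constant, and $\mathrm{Li}_3$ is the trilogarithm, $\mathrm{Li}_3(z)=\sum_{k\ge1}z^k/k^3$ for $|z|\le1$, analytically continued to $\mathbb C\setminus[1,\infty)$ (principal branch); $\Im(\mathrm{Li}_3(1+i))\approx1.2670834419$. Empty sums (such as $\sum_{j=0}^{-1}$) are $0$. *)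

theory Defs
  imports "HOL-Complex_Analysis.Complex_Analysis"
begin

definition catalan :: real
  where "catalan = (\<Sum>k. (-1) ^ k / (2 * real k + 1)\<^sup>2)"

text \<open>
  The trilogarithm: its power series on the closed unit disc, and elsewhere the analytic
  continuation of that series to the plane cut along \<open>[1, \<infinity>)\<close>. The continuation exists and is
  unique (lemmas \<open>Li3_continuation_exists\<close> and \<open>Li3_continuation_unique\<close> below), so the
  description operator is well defined off the cut; on the open cut \<open>(1, \<infinity>)\<close>
  the value is unspecified.
\<close>

definition Li3_series :: "complex \<Rightarrow> complex"
  where "Li3_series z = (\<Sum>k. z ^ Suc k / of_nat (Suc k) ^ 3)"

definition cut_plane :: "complex set"
  where "cut_plane = - (complex_of_real ` {1..})"

definition Li3_continuation :: "(complex \<Rightarrow> complex) \<Rightarrow> bool"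
  where "Li3_continuation f \<longleftrightarrow>
    f holomorphic_on cut_plane \<and> (\<forall>z\<in>ball 0 1. f z = Li3_series z)"

definition Li3 :: "complex \<Rightarrow> complex"
  where "Li3 z = (if norm z \<le> 1 then Li3_series z
                  else (THE w. \<exists>f. Li3_continuation f \<and> f z = w))"

definition Theta1 :: "nat \<Rightarrow> real"
  where "Theta1 n =
    (\<Sum>i. let k = real (Suc i)
          in (Digamma ((2 * k + 2 * real n + 5) / 4) - Digamma ((2 * k + 2 * real n + 3) / 4))
             / (2 * k)\<^sup>2)"

subsection \<open>Convergence of the series\<close>

lemma Theta1_summable:
  "summable (\<lambda>i. let k = real (Suc i)
     in (Digamma ((2 * k + 2 * real n + 5) / 4) - Digamma ((2 * k + 2 * real n + 3) / 4))
        / (2 * k)\<^sup>2)"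
proof (rule summable_comparison_test')
  show "summable (\<lambda>i. inverse (real (Suc i) ^ 2))"
    using inverse_power_summable[of 2, where 'a = real] by (subst summable_Suc_iff) simp
next
  fix i :: nat
  define k where "k = real (Suc i)"
  have k: "k \<ge> 1" by (simp add: k_def)
  define x where "x = (2 * k + 2 * real n + 3) / 4"
  have x: "x \<ge> 1" using k by (simp add: x_def)
  have eq: "(2 * k + 2 * real n + 5) / 4 = x + 1/2" by (simp add: x_def field_simps)
  have "Digamma x \<le> Digamma (x + 1/2)" "Digamma (x + 1/2) \<le> Digamma (x + 1)"
    using x by (intro Digamma_real_mono; simp)+
  moreover have "Digamma (x + 1) = Digamma x + 1 / x"
    using x by (intro Digamma_plus1) simp
  moreover have "1 / x \<le> 1" using x by simp
  ultimately have "\<bar>Digamma (x + 1/2) - Digamma x\<bar> \<le> 1" by linarith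
  hence "\<bar>Digamma (x + 1/2) - Digamma x\<bar> / (2 * k)\<^sup>2 \<le> 1 / k\<^sup>2"
    using k by (intro frac_le) (auto simp: power_mult_distrib)
  hence "norm ((Digamma ((2 * k + 2 * real n + 5) / 4) - Digamma ((2 * k + 2 * real n + 3) / 4))
        / (2 * k)\<^sup>2) \<le> inverse (k ^ 2)"
    unfolding eq x_def[symmetric] by (simp add: abs_divide inverse_eq_divide)
  thus "norm (let k = real (Suc i)
     in (Digamma ((2 * k + 2 * real n + 5) / 4) - Digamma ((2 * k + 2 * real n + 3) / 4))
        / (2 * k)\<^sup>2) \<le> inverse (real (Suc i) ^ 2)"
    by (simp only: Let_def k_def)
qed

subsection \<open>The analytic continuation of the trilogarithm\<close>

lemma cut_planeI: "Re z < 1 \<Longrightarrow> z \<in> cut_plane"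
  by (auto simp: cut_plane_def)

lemma ball_subset_cut_plane: "ball 0 1 \<subseteq> cut_plane"
proof
  fix z :: complex assume "z \<in> ball 0 1"
  thus "z \<in> cut_plane" using complex_Re_le_cmod[of z] by (intro cut_planeI) auto
qed

lemma open_cut_plane: "open cut_plane"
  unfolding cut_plane_def
  by (intro open_Compl closed_injective_linear_image linear_of_real) (auto simp: inj_on_def)

lemma cut_plane_segment:
  assumes "z \<in> cut_plane"
  shows "closed_segment 0 z \<subseteq> cut_plane"
proof
  fix w assume "w \<in> closed_segment 0 z"
  then obtain u where u: "0 \<le> u" "u \<le> 1" "w = u *\<^sub>R z" by (auto simp: in_segment)
  show "w \<in> cut_plane"
  proof (rule ccontr)
    assume "w \<notin> cut_plane"
    then obtain x where x: "x \<ge> 1" "u *\<^sub>R z = of_real x" using u by (auto simp: cut_plane_def)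
    hence "u \<noteq> 0" by auto
    hence "z = of_real (x / u)" using x by (auto simp: scaleR_conv_of_real field_simps)
    moreover have "x / u \<ge> 1" using x u \<open>u \<noteq> 0\<close> by (simp add: field_simps)
    ultimately show False using assms unfolding cut_plane_def by blast
  qed
qed

lemma starlike_cut_plane: "starlike cut_plane"
  unfolding starlike_def using cut_plane_segment cut_planeI[of 0] by (intro bexI[of _ 0]) auto

lemma Li3_continuation_unique:
  assumes "Li3_continuation f" "Li3_continuation g" "z \<in> cut_plane"
  shows "f z = g z"
proof (rule analytic_continuation_open[of "ball 0 1" cut_plane f g])
  show "connected cut_plane" by (rule starlike_imp_connected[OF starlike_cut_plane])
qed (use assms open_cut_plane ball_subset_cut_plane in \<open>auto simp: Li3_continuation_def\<close>)

lemma polylog_continuation_aux: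
  "\<exists>f. f holomorphic_on cut_plane \<and>
       (\<forall>z\<in>ball 0 1. (\<lambda>k. z ^ Suc k / of_nat (Suc k) ^ m) sums f z)"
proof (induction m)
  case 0
  have "(\<lambda>z. z / (1 - z)) holomorphic_on cut_plane"
    by (intro holomorphic_intros) (auto simp: cut_plane_def image_iff intro: bexI[of _ 1])
  moreover have "(\<lambda>k. z ^ Suc k) sums (z / (1 - z))" if "z \<in> ball 0 1" for z :: complex
    using sums_mult[OF geometric_sums[of z], of z] that by simp
  ultimately show ?case by (intro exI[of _ "\<lambda>z. z / (1 - z)"]) auto
next
  case (Suc m)
  then obtain f where f: "f holomorphic_on cut_plane"
    and fs: "\<And>z. z \<in> ball 0 1 \<Longrightarrow> (\<lambda>k. z ^ Suc k / of_nat (Suc k) ^ m) sums f z" by blast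
  have zero_in: "0 \<in> cut_plane" by (simp add: cut_planeI)
  have f0: "f 0 = 0" using sums_unique[OF fs[of 0]] by simp
  define h where "h = (\<lambda>z. if z = 0 then deriv f 0 else f z / z)"
  have h: "h holomorphic_on cut_plane"
    using pole_lemma[OF f, of 0] f0 zero_in
    by (simp add: h_def interior_open[OF open_cut_plane] cong: if_cong)
  obtain g where g: "\<And>z. z \<in> cut_plane \<Longrightarrow> (g has_field_derivative h z) (at z)"
    using holomorphic_starlike_primitive[OF holomorphic_on_imp_continuous_on[OF h]
        starlike_cut_plane open_cut_plane, of "{}"]
      holomorphic_on_imp_differentiable_at[OF h open_cut_plane] by auto
  define c :: "nat \<Rightarrow> complex" where "c = (\<lambda>k. if k = 0 then 0 else 1 / of_nat k ^ Suc m)"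
  have c_summable: "summable (\<lambda>k. c k * z ^ k)" if "norm z < 1" for z
  proof (rule summable_comparison_test')
    show "summable (\<lambda>k. norm z ^ k)" using that by (simp add: summable_geometric)
    fix k :: nat
    have "norm (c k) \<le> 1"
    proof (cases "k = 0")
      case False
      hence "1 \<le> real k ^ Suc m" by (intro one_le_power) simp
      thus ?thesis using False
        by (simp only: c_def if_False norm_divide norm_one norm_power norm_of_nat) simp
    qed (simp add: c_def)
    thus "norm (c k * z ^ k) \<le> norm z ^ k"
      using mult_right_mono[of "norm (c k)" 1 "norm z ^ k"] by (simp add: norm_mult norm_power)
  qed
  have diffs_c: "diffs c k = 1 / of_nat (Suc k) ^ m" for k
    by (simp add: diffs_def c_def del: of_nat_Suc)
  define P where "P = (\<lambda>z. \<Sum>k. c k * z ^ k)"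
  have P_deriv: "(P has_field_derivative (\<Sum>k. diffs c k * z ^ k)) (at z)" if "norm z < 1" for z
    unfolding P_def by (rule termdiffs_strong'[of 1]) (use that c_summable in auto)
  have P_deriv': "(P has_field_derivative h z) (at z)" if z: "z \<in> ball 0 1" "z \<noteq> 0" for z
  proof -
    have "(\<lambda>k. (z ^ Suc k / of_nat (Suc k) ^ m) / z) sums (f z / z)"
      by (rule sums_divide[OF fs[OF z(1)]])
    also have "(\<lambda>k. (z ^ Suc k / of_nat (Suc k) ^ m) / z) = (\<lambda>k. diffs c k * z ^ k)"
      using z by (simp add: diffs_c fun_eq_iff del: of_nat_Suc)
    finally have "(\<Sum>k. diffs c k * z ^ k) = h z" using z by (simp add: sums_iff h_def)
    with P_deriv[of z] z show ?thesis by simp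
  qed
  have const: "\<exists>d. \<forall>z\<in>ball 0 1. g z - P z = d"
  proof (rule DERIV_zero_connected_constant[of "ball 0 1" "{0}", THEN exE])
    show "continuous_on (ball 0 1) (\<lambda>z. g z - P z)"
      using g P_deriv ball_subset_cut_plane
      by (intro continuous_at_imp_continuous_on ballI continuous_diff)
         (meson DERIV_isCont subsetD, simp add: DERIV_isCont[OF P_deriv])
    show "\<forall>z\<in>ball 0 1 - {0}. ((\<lambda>z. g z - P z) has_field_derivative 0) (at z)"
    proof
      fix z :: complex assume z: "z \<in> ball 0 1 - {0}"
      have "((\<lambda>z. g z - P z) has_field_derivative (h z - h z)) (at z)"
        using z ball_subset_cut_plane by (intro DERIV_diff g P_deriv') auto
      thus "((\<lambda>z. g z - P z) has_field_derivative 0) (at z)" by simp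
    qed
  qed (auto)
  then obtain d where d: "\<And>z. z \<in> ball 0 1 \<Longrightarrow> g z - P z = d" by blast
  show ?case
  proof (intro exI[of _ "\<lambda>z. g z - d"] conjI ballI)
    show "(\<lambda>z. g z - d) holomorphic_on cut_plane"
      using g by (intro holomorphic_intros) (auto simp: holomorphic_on_open[OF open_cut_plane])
    fix z :: complex assume z: "z \<in> ball 0 1"
    have "(\<lambda>k. c k * z ^ k) sums P z"
      unfolding P_def using c_summable z by (intro summable_sums) auto
    hence "(\<lambda>k. c (Suc k) * z ^ Suc k) sums P z"
      by (subst sums_Suc_iff) (simp add: c_def)
    also have "P z = g z - d" using d[OF z] by (simp add: algebra_simps)
    finally show "(\<lambda>k. z ^ Suc k / of_nat (Suc k) ^ Suc m) sums (g z - d)"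
      by (simp add: c_def del: of_nat_Suc power_Suc)
  qed
qed

lemma Li3_continuation_exists: "\<exists>f. Li3_continuation f"
  using polylog_continuation_aux[of 3]
  by (auto simp: Li3_continuation_def Li3_series_def sums_iff)

lemma Li3_eq_off_disc:
  assumes "Li3_continuation f" "z \<in> cut_plane" "norm z > 1"
  shows "Li3 z = f z"
proof -
  have "(THE w. \<exists>g. Li3_continuation g \<and> g z = w) = f z"
    using assms Li3_continuation_unique by (intro the_equality) blast+
  with assms show ?thesis by (simp add: Li3_def)
qed

lemma continuous_on_Li3_series: "continuous_on (cball 0 1) Li3_series"
proof (rule uniform_limit_theorem)
  show "uniform_limit (cball 0 1) (\<lambda>n z. \<Sum>k<n. z ^ Suc k / of_nat (Suc k) ^ 3)
          Li3_series sequentially"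
    unfolding Li3_series_def[abs_def]
  proof (rule Weierstrass_m_test)
    show "summable (\<lambda>k. inverse (real (Suc k) ^ 3))"
      using inverse_power_summable[of 3, where 'a = real] by (subst summable_Suc_iff) simp
    fix k :: nat and z :: complex assume "z \<in> cball 0 1"
    hence "norm z ^ Suc k \<le> 1" by (intro power_le_one) auto
    thus "norm (z ^ Suc k / of_nat (Suc k) ^ 3) \<le> inverse (real (Suc k) ^ 3)"
      by (simp add: norm_divide norm_power divide_simps del: of_nat_Suc power_Suc)
  qed
qed (auto intro!: always_eventually continuous_intros simp del: of_nat_Suc)

lemma Li3_eq_continuation:
  assumes f: "Li3_continuation f" and z: "z \<in> cut_plane"
  shows "Li3 z = f z"
proof (cases "norm z \<le> 1")
  case True
  have lim: "((\<lambda>t. of_real t * z) \<longlongrightarrow> z) (at_left (1::real))"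
    by (auto intro!: tendsto_eq_intros)
  have in_ball: "\<forall>\<^sub>F t in at_left (1::real). of_real t * z \<in> ball 0 1"
  proof (rule eventually_mono[OF eventually_at_left_real[of 0 1]])
    fix t :: real assume t: "t \<in> {0<..<1}"
    hence "t * norm z \<le> t * 1" using True by (intro mult_left_mono) auto
    hence "t * norm z < 1" using t unfolding greaterThanLessThan_iff by linarith
    thus "of_real t * z \<in> ball 0 1" using t by (simp add: norm_mult)
  qed simp
  have "isCont f z"
    using f z holomorphic_on_imp_continuous_on continuous_on_eq_continuous_at[OF open_cut_plane]
    unfolding Li3_continuation_def by blast
  hence 1: "((\<lambda>t. f (of_real t * z)) \<longlongrightarrow> f z) (at_left (1::real))"
    using lim by (rule isCont_tendsto_compose)
  have 2: "((\<lambda>t. Li3_series (of_real t * z)) \<longlongrightarrow> Li3_series z) (at_left (1::real))"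
  proof (rule continuous_on_tendsto_compose[OF continuous_on_Li3_series lim])
    show "z \<in> cball 0 1" using True by simp
    show "\<forall>\<^sub>F t in at_left (1::real). of_real t * z \<in> cball 0 1"
      by (rule eventually_mono[OF in_ball]) (rule subsetD[OF ball_subset_cball])
  qed
  have "\<forall>\<^sub>F t in at_left (1::real). Li3_series (of_real t * z) = f (of_real t * z)"
    by (rule eventually_mono[OF in_ball]) (use f in \<open>simp add: Li3_continuation_def\<close>)
  with 2 have "((\<lambda>t. f (of_real t * z)) \<longlongrightarrow> Li3_series z) (at_left (1::real))"
    by (rule Lim_transform_eventually)
  with 1 have "f z = Li3_series z"
    by (rule tendsto_unique[OF trivial_limit_at_left_real])
  thus ?thesis using True by (simp add: Li3_def)
qed (use assms Li3_eq_off_disc in auto)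

end

theory Submission
  imports Defs
begin

text \<open>
  Writing the digamma differences as \<open>4 * dgap k\<close> with \<open>dgap k + dgap (k + 1) = 1 / (2 * k + 1)\<close>, the sums
  \<open>\<Theta>(n) + \<Theta>(n + 1)\<close> are elementary by partial fractions, so everything reduces to the formal value
  \<open>\<Theta>(-1) = \<Sum>k. dgap k / k^2\<close>. Integrating the generating function of \<open>dgap\<close> against \<open>ln t\<close> turns it into
  \<open>2 \<langle>ln t ln (1 - t)\<rangle> - 2 \<langle>ln t ln (1 + t)\<rangle> - \<pi>^3 / 48\<close>, where \<open>\<langle>f\<rangle>\<close> is the integral of \<open>f / (1 + t^2)\<close>
  over \<open>(0, 1)\<close>.

  These two integrals solve a linear system. On the one hand \<open>2 Li3(z)\<close> is the integral of
  \<open>(ln t)^2 z / (1 - t z)\<close>; taking imaginary parts at \<open>z = \<i>, 1 + \<i>, -1 + \<i>\<close> and at the inverses, and using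
  the inversion formula for \<open>Li3(z) - Li3(1/z)\<close>, gives \<open>\<langle>(ln t)^2\<rangle>\<close>, \<open>\<langle>(ln (1 - t))^2\<rangle>\<close>,
  \<open>\<langle>(ln (1 + t))^2 + (ln t - ln (1 + t))^2\<rangle>\<close> and \<open>\<langle>(ln (1 - t) - ln t)^2\<rangle>\<close> in terms of \<open>Im (Li3 (1 + \<i>))\<close>.
  On the other hand \<open>\<langle>f\<rangle>\<close> is invariant under \<open>t \<mapsto> (1 - t) / (1 + t)\<close>.
\<close>

subsection \<open>Polylogarithms on the cut plane\<close>

text \<open>Describes the branch of Li_m on the cut plane. A predicate suits the source of these
  functions: \<open>polylog_continuation_aux\<close> only asserts existence, and each proof obtains
  the orders it needs.\<close>

definition is_polylog :: "nat \<Rightarrow> (complex \<Rightarrow> complex) \<Rightarrow> bool"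
  where "is_polylog m f \<longleftrightarrow> f holomorphic_on cut_plane \<and>
    (\<forall>z\<in>ball 0 1. (\<lambda>k. z ^ Suc k / of_nat (Suc k) ^ m) sums f z)"

lemma is_polylog_exists: "\<exists>f. is_polylog m f"
  using polylog_continuation_aux unfolding is_polylog_def .

lemma is_polylog_zero:
  assumes "is_polylog m f" shows "f 0 = 0"
proof -
  have "(\<lambda>k. (0::complex) ^ Suc k / of_nat (Suc k) ^ m) sums f 0"
    using assms unfolding is_polylog_def by (rule conjE) (simp only: centre_in_ball zero_less_one ball_simps)
  thus ?thesis using sums_unique2[OF _ sums_zero] by simp
qed

lemma connected_cut_plane: "connected cut_plane"
  by (rule starlike_imp_connected[OF starlike_cut_plane])

lemma holomorphic_on_cut_plane_eqI:
  assumes "f holomorphic_on cut_plane" "g holomorphic_on cut_plane"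
    and "\<And>z. z \<in> ball 0 1 \<Longrightarrow> f z = g z" and "z \<in> cut_plane"
  shows "f z = g z"
  by (rule analytic_continuation_open[of "ball 0 1" cut_plane f g])
     (use assms open_cut_plane ball_subset_cut_plane connected_cut_plane in auto)

text \<open>By the identity theorem it suffices to compare on the unit disc, where termwise
  differentiation lowers the exponent of k in the denominator by one. The product form stays
  meaningful at z = 0.\<close>

lemma is_polylog_deriv:
  assumes f: "is_polylog m f" and g: "is_polylog (Suc m) g" and z: "z \<in> cut_plane"
  shows "z * deriv g z = f z"
proof (rule holomorphic_on_cut_plane_eqI[OF _ _ _ z])
  show "(\<lambda>z. z * deriv g z) holomorphic_on cut_plane"
    using g open_cut_plane by (auto simp: is_polylog_def intro!: holomorphic_intros)
  show "f holomorphic_on cut_plane" using f by (simp add: is_polylog_def)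
  fix z :: complex assume z: "z \<in> ball 0 1"
  \<comment> \<open>The series of \<open>g\<close> starts at exponent 1; a zero coefficient at index
    0 turns it into an ordinary power series for \<open>diffs\<close>.\<close>
  define c :: "nat \<Rightarrow> complex" where "c = (\<lambda>k. if k = 0 then 0 else 1 / of_nat k ^ Suc m)"
  have c_sums: "(\<lambda>k. c k * w ^ k) sums g w" if "w \<in> ball 0 1" for w
  proof -
    have "(\<lambda>k. c (Suc k) * w ^ Suc k) sums g w"
      using g that by (simp add: c_def is_polylog_def del: of_nat_Suc power_Suc)
    thus ?thesis by (subst (asm) sums_Suc_iff) (simp add: c_def)
  qed
  have "((\<lambda>w. \<Sum>k. c k * w ^ k) has_field_derivative (\<Sum>k. diffs c k * z ^ k)) (at z)"
    by (rule termdiffs_strong'[of 1]) (use c_sums z in \<open>auto simp: sums_iff\<close>)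
  hence "(g has_field_derivative (\<Sum>k. diffs c k * z ^ k)) (at z)"
    by (rule has_field_derivative_transform_within_open[of _ _ _ "ball 0 1"])
       (use c_sums z in \<open>auto simp: sums_iff\<close>)
  hence "deriv g z = (\<Sum>k. diffs c k * z ^ k)" by (rule DERIV_imp_deriv)
  moreover have "diffs c k = 1 / of_nat (Suc k) ^ m" for k
    by (simp add: diffs_def c_def del: of_nat_Suc)
  moreover have "summable (\<lambda>k. diffs c k * z ^ k)"
    by (rule termdiff_converges[of z 1]) (use c_sums z in \<open>auto simp: sums_iff\<close>)
  ultimately have "(\<lambda>k. z * (1 / of_nat (Suc k) ^ m * z ^ k)) sums (z * deriv g z)"
    by (intro sums_mult) (simp add: sums_iff)
  hence "(\<lambda>k. z ^ Suc k / of_nat (Suc k) ^ m) sums (z * deriv g z)"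
    by (simp add: field_simps)
  thus "z * deriv g z = f z"
    using f z sums_unique2 unfolding is_polylog_def by blast
qed

lemma is_polylog_0:
  assumes f: "is_polylog 0 f" and z: "z \<in> cut_plane"
  shows "f z = z / (1 - z)"
proof (rule holomorphic_on_cut_plane_eqI[OF _ _ _ z])
  show "f holomorphic_on cut_plane" using f by (simp add: is_polylog_def)
  show "(\<lambda>z. z / (1 - z)) holomorphic_on cut_plane"
    by (intro holomorphic_intros) (auto simp: cut_plane_def image_iff intro: bexI[of _ 1])
  fix z :: complex assume z: "z \<in> ball 0 1"
  have "(\<lambda>k. z ^ Suc k) sums (z / (1 - z))"
    using sums_mult[OF geometric_sums[of z], of z] z by simp
  thus "f z = z / (1 - z)" using f z sums_unique2 unfolding is_polylog_def by fastforce
qed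

lemma is_polylog_has_field_derivative:
  assumes f: "is_polylog m f" and g: "is_polylog (Suc m) g" and z: "z \<in> cut_plane" "z \<noteq> 0"
  shows "(g has_field_derivative f z / z) (at z)"
proof -
  have "(g has_field_derivative deriv g z) (at z)"
    using g z(1) open_cut_plane by (auto simp: is_polylog_def intro: holomorphic_derivI)
  moreover have "deriv g z = f z / z"
    using is_polylog_deriv[OF f g z(1)] z(2) by (simp add: field_simps)
  ultimately show ?thesis by simp
qed

lemma Li3_eq_polylog:
  assumes "is_polylog 3 f" "z \<in> cut_plane" shows "Li3 z = f z"
  using assms by (intro Li3_eq_continuation)
    (auto simp: Li3_continuation_def Li3_series_def is_polylog_def sums_iff)

section \<open>Polylogarithms along rays from the origin and their logarithmic integrals\<close>

lemma of_real_mult_in_cut_plane: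
  assumes "z \<in> cut_plane" "t \<in> {0..1}" shows "of_real t * z \<in> cut_plane"
  using cut_plane_segment[OF assms(1)] assms(2)
  by (auto simp: in_segment scaleR_conv_of_real image_iff subset_iff)

text \<open>With s = - ln t the expression is, up to sign, s^j / exp s as s tends to
  infinity.\<close>

lemma tendsto_mult_ln_power_at_right_0: "((\<lambda>t::real. t * ln t ^ j) \<longlongrightarrow> 0) (at_right 0)"
proof -
  have "filterlim (\<lambda>t::real. - ln t) at_top (at_right 0)"
    using ln_at_0 by (simp add: filterlim_uminus_at_bot)
  from filterlim_compose[OF tendsto_power_div_exp_0[of j] this]
  have "((\<lambda>t::real. (-1) ^ j * ((- ln t) ^ j / exp (- ln t))) \<longlongrightarrow> (-1) ^ j * 0) (at_right 0)"
    by (intro tendsto_mult tendsto_const)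
  moreover have "\<forall>\<^sub>F t::real in at_right 0. (-1) ^ j * ((- ln t) ^ j / exp (- ln t)) = t * ln t ^ j"
    using eventually_at_right_less[of 0]
    by eventually_elim (simp add: exp_minus power_minus[of "ln _"] divide_simps)
  ultimately show ?thesis by (simp add: tendsto_cong)
qed

text \<open>Provides continuity up to the endpoints for the antiderivatives below. At t = 0 the
  simple zero of \<open>f\<close> beats any power of the logarithm: the function is t (ln t)^j times
  the bounded quotient f(tz) / (tz) times z.\<close>

lemma continuous_on_ln_power_mult_polylog:
  assumes polylog: "is_polylog m f" and z: "z \<in> cut_plane"
  shows "continuous_on {0..1} (\<lambda>t::real. of_real (ln t ^ j) * f (of_real t * z))"
proof (cases "z = 0")
  case True
  thus ?thesis using is_polylog_zero[OF polylog] by simp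
next
  case z0: False
  have f: "f holomorphic_on cut_plane" "f 0 = 0"
    using polylog is_polylog_zero[OF polylog] by (simp_all add: is_polylog_def)
  let ?h = "\<lambda>t::real. of_real (ln t ^ j) * f (of_real t * z)"
  note mem = of_real_mult_in_cut_plane[OF z]
  have fc: "isCont f w" if "w \<in> cut_plane" for w
    using f(1) that holomorphic_on_imp_continuous_on continuous_on_eq_continuous_at[OF open_cut_plane]
    by blast
  have "(f has_field_derivative deriv f 0) (at 0)"
    using f(1) open_cut_plane cut_planeI[of 0] by (auto intro: holomorphic_derivI)
  hence "((\<lambda>w. f w / w) \<longlongrightarrow> deriv f 0) (at 0)"
    using f(2) by (simp add: has_field_derivative_iff)
  moreover have "filterlim (\<lambda>t::real. of_real t * z) (at 0) (at_right 0)"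
    using z0 by (auto simp: filterlim_at eventually_at_right_less[of 0] intro!: tendsto_eq_intros
        eventually_mono[OF eventually_at_right_less[of 0]])
  ultimately have quot: "((\<lambda>t::real. f (of_real t * z) / (of_real t * z)) \<longlongrightarrow> deriv f 0) (at_right 0)"
    by (rule filterlim_compose)
  have "continuous (at t within {0..1}) ?h" if t: "t \<in> {0..1}" for t
  proof (cases "t = 0")
    case False
    have "isCont (\<lambda>t::real. of_real t * z) t" by (intro continuous_intros)
    hence "isCont (\<lambda>t::real. f (of_real t * z)) t" by (rule isCont_o2) (rule fc[OF mem[OF t]])
    moreover have "isCont (\<lambda>t::real. of_real (ln t ^ j) :: complex) t"
      using False by (intro continuous_intros) auto
    ultimately have "isCont ?h t" by (intro continuous_mult)
    thus ?thesis by (rule continuous_at_imp_continuous_at_within)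
  next
    case True
    from tendsto_mult[OF tendsto_of_real[OF tendsto_mult_ln_power_at_right_0[of j]]
        tendsto_mult[OF quot tendsto_const[of z]]]
    have "((\<lambda>t::real. of_real (t * ln t ^ j) * (f (of_real t * z) / (of_real t * z) * z)) \<longlongrightarrow> 0) (at_right 0)"
      by simp
    moreover have "\<forall>\<^sub>F t::real in at_right 0.
        of_real (t * ln t ^ j) * (f (of_real t * z) / (of_real t * z) * z) = ?h t"
      by (rule eventually_mono[OF eventually_at_right_less[of 0]]) (use z0 in \<open>simp add: field_simps\<close>)
    ultimately have "(?h \<longlongrightarrow> 0) (at_right 0)" by (rule Lim_transform_eventually)
    hence "(?h \<longlongrightarrow> ?h 0) (at 0 within {0..1})"
      using f(2) at_within_Icc_at_right[of 0 "1::real"] by simp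
    thus ?thesis using True by (simp add: continuous_within)
  qed
  thus ?thesis by (simp add: continuous_on_eq_continuous_within)
qed

lemma polylog_ray_has_vector_derivative:
  assumes f: "is_polylog m f" and g: "is_polylog (Suc m) g"
    and z: "z \<in> cut_plane" and t: "t \<in> {0<..<1}"
  shows "((\<lambda>t. g (of_real t * z)) has_vector_derivative f (of_real t * z) / of_real t) (at t)"
proof (cases "z = 0")
  case True
  thus ?thesis using is_polylog_zero[OF f] by simp
next
  case False
  have w: "of_real t * z \<in> cut_plane" "of_real t * z \<noteq> 0"
    using of_real_mult_in_cut_plane[OF z] t False by auto
  have ray: "((\<lambda>t::real. of_real t * z) has_vector_derivative z) (at t)"
    by (auto intro!: derivative_eq_intros)
  show ?thesis
    using field_vector_diff_chain_at[OF ray is_polylog_has_field_derivative[OF f g w]] w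
    by (simp add: o_def field_simps)
qed

lemma of_real_ln_power_has_vector_derivative:
  assumes "t > 0"
  shows "((\<lambda>t. of_real (ln t ^ j) :: complex) has_vector_derivative
           of_real (real j * ln t ^ (j - 1) / t)) (at t)"
proof -
  have "((\<lambda>t. ln t ^ j) has_real_derivative real j * ln t ^ (j - 1) / t) (at t)"
    using assms by (auto intro!: derivative_eq_intros)
  thus ?thesis by (rule has_vector_derivative_of_real)
qed

text \<open>The kernel is Li_0(tz) / t, and t d/dt Li_(m+1)(tz) = Li_m(tz), so integration by parts
  gives the antiderivative ln t Li_1(tz) - Li_2(tz). Only - Li_2(z) survives at the
  endpoints.\<close>

lemma has_integral_ln_polylog_kernel:
  assumes f: "is_polylog 2 f" and z: "z \<in> cut_plane"
  shows "((\<lambda>t. of_real (ln t) * (z / (1 - of_real t * z))) has_integral - f z) {0..1}"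
proof -
  obtain f0 f1 where f0: "is_polylog 0 f0" and f1: "is_polylog 1 f1"
    using is_polylog_exists by blast
  \<comment> \<open>The powers 1 and 0 are kept explicit so that every term has the shape required
    by \<open>continuous_on_ln_power_mult_polylog\<close>.\<close>
  define H where "H t = of_real (ln t ^ 1) * f1 (of_real t * z) - of_real (ln t ^ 0) * f (of_real t * z)" for t :: real
  have "((\<lambda>t. of_real (ln t) * (z / (1 - of_real t * z))) has_integral H 1 - H 0) {0..1}"
  proof (rule fundamental_theorem_of_calculus_interior)
    show "continuous_on {0..1} H"
      unfolding H_def
      by (intro continuous_on_diff continuous_on_ln_power_mult_polylog[OF _ z]) (rule f f1)+
    fix t :: real assume t: "t \<in> {0<..<1}"
    have "f0 (of_real t * z) = of_real t * z / (1 - of_real t * z)"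
      using t by (intro is_polylog_0[OF f0] of_real_mult_in_cut_plane[OF z]) auto
    hence "f0 (of_real t * z) / of_real t = z / (1 - of_real t * z)" using t by simp
    hence d1: "((\<lambda>t. f1 (of_real t * z)) has_vector_derivative z / (1 - of_real t * z)) (at t)"
      using polylog_ray_has_vector_derivative[OF f0 _ z t, of f1] f1 by simp
    have d2: "((\<lambda>t. f (of_real t * z)) has_vector_derivative f1 (of_real t * z) / of_real t) (at t)"
      by (rule polylog_ray_has_vector_derivative[OF f1 _ z t]) (use f in \<open>simp add: eval_nat_numeral\<close>)
    show "(H has_vector_derivative of_real (ln t) * (z / (1 - of_real t * z))) (at t)"
      unfolding H_def
      by (rule has_vector_derivative_eq_rhs)
         (rule has_vector_derivative_diff has_vector_derivative_mult d1 d2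
            of_real_ln_power_has_vector_derivative | use t in \<open>simp add: algebra_simps; fail\<close>)+
  qed simp
  moreover have "H 1 - H 0 = - f z" using is_polylog_zero[OF f] is_polylog_zero[OF f1] by (simp add: H_def)
  ultimately show ?thesis by simp
qed

text \<open>One order higher, integrating by parts twice produces the coefficients 1, -2, 2 in
  \<open>H\<close>; at t = 1 only the Li_3 term is left.\<close>

lemma has_integral_ln_squared_polylog_kernel:
  assumes f: "is_polylog 3 f" and z: "z \<in> cut_plane"
  shows "((\<lambda>t. of_real ((ln t)\<^sup>2) * (z / (1 - of_real t * z))) has_integral 2 * f z) {0..1}"
proof -
  obtain f0 f1 f2 where f0: "is_polylog 0 f0" and f1: "is_polylog 1 f1" and f2: "is_polylog 2 f2"
    using is_polylog_exists by blast
  define H where "H t = of_real (ln t ^ 2) * f1 (of_real t * z)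
     - 2 * (of_real (ln t ^ 1) * f2 (of_real t * z)) + 2 * (of_real (ln t ^ 0) * f (of_real t * z))" for t :: real
  have "((\<lambda>t. of_real ((ln t)\<^sup>2) * (z / (1 - of_real t * z))) has_integral H 1 - H 0) {0..1}"
  proof (rule fundamental_theorem_of_calculus_interior)
    show "continuous_on {0..1} H"
      unfolding H_def
      by (intro continuous_on_add continuous_on_diff continuous_on_mult continuous_on_const
            continuous_on_ln_power_mult_polylog[OF _ z]) (rule f f1 f2)+
    fix t :: real assume t: "t \<in> {0<..<1}"
    have "f0 (of_real t * z) = of_real t * z / (1 - of_real t * z)"
      using t by (intro is_polylog_0[OF f0] of_real_mult_in_cut_plane[OF z]) auto
    hence "f0 (of_real t * z) / of_real t = z / (1 - of_real t * z)" using t by simp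
    hence d1: "((\<lambda>t. f1 (of_real t * z)) has_vector_derivative z / (1 - of_real t * z)) (at t)"
      using polylog_ray_has_vector_derivative[OF f0 _ z t, of f1] f1 by simp
    have d2: "((\<lambda>t. f2 (of_real t * z)) has_vector_derivative f1 (of_real t * z) / of_real t) (at t)"
      by (rule polylog_ray_has_vector_derivative[OF f1 _ z t]) (use f2 in \<open>simp add: eval_nat_numeral\<close>)
    have d3: "((\<lambda>t. f (of_real t * z)) has_vector_derivative f2 (of_real t * z) / of_real t) (at t)"
      by (rule polylog_ray_has_vector_derivative[OF f2 _ z t]) (use f in \<open>simp add: eval_nat_numeral\<close>)
    show "(H has_vector_derivative of_real ((ln t)\<^sup>2) * (z / (1 - of_real t * z))) (at t)"
      unfolding H_def
      by (rule has_vector_derivative_eq_rhs)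
         (rule has_vector_derivative_add has_vector_derivative_diff has_vector_derivative_mult
            has_vector_derivative_const d1 d2 d3 of_real_ln_power_has_vector_derivative
          | use t in \<open>simp add: algebra_simps; fail\<close>)+
  qed simp
  moreover have "H 1 - H 0 = 2 * f z"
    using is_polylog_zero[OF f] is_polylog_zero[OF f1] is_polylog_zero[OF f2] by (simp add: H_def)
  ultimately show ?thesis by simp
qed

subsection \<open>The inversion formula\<close>

text \<open>Reduces each inversion formula to a derivative computation and an evaluation at 1, the
  fixed point of w -> 1/w in the slit plane.\<close>

lemma slit_plane_constant:
  assumes der: "\<And>w. w \<in> - \<real>\<^sub>\<le>\<^sub>0 \<Longrightarrow> (h has_field_derivative 0) (at w)" and w: "w \<in> - \<real>\<^sub>\<le>\<^sub>0"
  shows "h w = h (1::complex)"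
proof -
  have "open (- \<real>\<^sub>\<le>\<^sub>0 :: complex set)" by (simp add: closed_nonpos_Reals_complex open_Compl)
  moreover have "connected (- \<real>\<^sub>\<le>\<^sub>0 :: complex set)"
  proof -
    have eq: "\<real>\<^sub>\<le>\<^sub>0 = complex_of_real ` {..0}" by (auto simp: nonpos_Reals_def)
    show ?thesis
      unfolding eq by (rule starlike_imp_connected[OF starlike_slotted_complex_plane_left])
  qed
  ultimately obtain c where "\<And>v. v \<in> - \<real>\<^sub>\<le>\<^sub>0 \<Longrightarrow> h v = c"
    using DERIV_zero_connected_constant[of "- \<real>\<^sub>\<le>\<^sub>0" "{}" h] der
    by (metis Diff_empty finite.emptyI DERIV_isCont continuous_at_imp_continuous_on)
  moreover have "(1::complex) \<in> - \<real>\<^sub>\<le>\<^sub>0" by (auto simp: complex_nonpos_Reals_iff)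
  ultimately show ?thesis using w by metis
qed

lemma uminus_slit_plane_subset_cut_plane:
  assumes "w \<in> - \<real>\<^sub>\<le>\<^sub>0" shows "- w \<in> cut_plane" "- (1 / w) \<in> cut_plane" "w \<noteq> 0"
proof -
  show w0: "w \<noteq> 0" using assms by auto
  show "- w \<in> cut_plane"
    using assms by (auto simp: cut_plane_def complex_nonpos_Reals_iff complex_eq_iff)
  show "- (1 / w) \<in> cut_plane"
  proof (rule ccontr)
    assume "- (1 / w) \<notin> cut_plane"
    then obtain x where x: "x \<ge> 1" "- (1 / w) = of_real x" by (auto simp: cut_plane_def)
    hence "w = of_real (- (1 / x))" using w0 by (auto simp: field_simps)
    thus False using assms x(1) by (auto simp: complex_nonpos_Reals_iff)
  qed
qed

context
  fixes w :: complex assumes w: "w \<in> - \<real>\<^sub>\<le>\<^sub>0"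
begin

lemma polylog_uminus_has_field_derivative:
  assumes "is_polylog m f" "is_polylog (Suc m) g"
  shows "((\<lambda>w. g (- w)) has_field_derivative f (- w) / w) (at w)"
proof -
  have "(g has_field_derivative f (- w) / - w) (at (- w))"
    using is_polylog_has_field_derivative[OF assms, of "- w"] uminus_slit_plane_subset_cut_plane[OF w]
    by simp
  moreover have "(uminus has_field_derivative -1) (at w)" by (auto intro!: derivative_eq_intros)
  ultimately have "((\<lambda>w. g (- w)) has_field_derivative f (- w) / - w * -1) (at w)" by (rule DERIV_chain2)
  thus ?thesis by simp
qed

lemma polylog_uminus_inverse_has_field_derivative:
  assumes "is_polylog m f" "is_polylog (Suc m) g"
  shows "((\<lambda>w. g (- (1 / w))) has_field_derivative - (f (- (1 / w)) / w)) (at w)"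
proof -
  have "((\<lambda>w. - (1 / w)) has_field_derivative 1 / w\<^sup>2) (at w)"
    using uminus_slit_plane_subset_cut_plane(3)[OF w]
    by (auto intro!: derivative_eq_intros simp: power2_eq_square)
  from DERIV_chain2[OF is_polylog_has_field_derivative[OF assms] this]
    uminus_slit_plane_subset_cut_plane[OF w]
  show ?thesis by (simp add: power2_eq_square)
qed

end

text \<open>The inversion formulas climb in the order: differentiating one gives the previous one
  divided by w. The chain starts from Li_0(-w) + Li_0(-1/w) = -1, and here the constant is 0 because
  the two values at w = 1 cancel.\<close>

lemma polylog_1_inversion:
  assumes f1: "is_polylog 1 f1" and w: "w \<in> - \<real>\<^sub>\<le>\<^sub>0"
  shows "f1 (- w) - f1 (- (1 / w)) = - Ln w"
proof -
  obtain f0 where f0: "is_polylog 0 f0" using is_polylog_exists by blast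
  have f1': "is_polylog (Suc 0) f1" using f1 by simp
  have "((\<lambda>w. f1 (- w) - f1 (- (1 / w)) + Ln w) has_field_derivative 0) (at w)"
    if w: "w \<in> - \<real>\<^sub>\<le>\<^sub>0" for w
  proof -
    have nz: "w \<noteq> 0" "1 + w \<noteq> 0" using w by (auto simp: complex_nonpos_Reals_iff complex_eq_iff)
    have "f0 (- w) + f0 (- (1 / w)) = -1"
      using nz uminus_slit_plane_subset_cut_plane[OF w]
      by (simp add: is_polylog_0[OF f0] divide_simps) (simp add: algebra_simps)
    hence "f0 (- w) / w - - (f0 (- (1 / w)) / w) + 1 / w = 0"
      using nz by (simp add: field_simps)
    thus ?thesis using w
      by (auto intro!: derivative_eq_intros polylog_uminus_has_field_derivative[OF w f0 f1']
          polylog_uminus_inverse_has_field_derivative[OF w f0 f1'] simp: inverse_eq_divide)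
  qed
  from slit_plane_constant[OF this w] show ?thesis by (simp add: algebra_simps)
qed

text \<open>The derivative is the order 1 formula divided by w. At this order the two values at w =
  1 add up, which leaves the constant 2 Li_2(-1).\<close>

lemma polylog_2_inversion:
  assumes f2: "is_polylog 2 f2" and w: "w \<in> - \<real>\<^sub>\<le>\<^sub>0"
  shows "f2 (- w) + f2 (- (1 / w)) = 2 * f2 (-1) - Ln w ^ 2 / 2"
proof -
  obtain f1 where f1: "is_polylog 1 f1" using is_polylog_exists by blast
  have f2': "is_polylog (Suc 1) f2" using f2 by (simp add: eval_nat_numeral)
  have "((\<lambda>w. f2 (- w) + f2 (- (1 / w)) + Ln w ^ 2 / 2) has_field_derivative 0) (at w)"
    if w: "w \<in> - \<real>\<^sub>\<le>\<^sub>0" for w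
  proof -
    have "f1 (- w) / w + - (f1 (- (1 / w)) / w) + Ln w / w = 0"
      using polylog_1_inversion[OF f1 w] uminus_slit_plane_subset_cut_plane(3)[OF w]
      by (simp add: field_simps)
    thus ?thesis using w
      by (auto intro!: derivative_eq_intros polylog_uminus_has_field_derivative[OF w f1 f2']
          polylog_uminus_inverse_has_field_derivative[OF w f1 f2'] simp: inverse_eq_divide)
  qed
  from slit_plane_constant[OF this w] show ?thesis by (simp add: algebra_simps)
qed

text \<open>Integrating the order 2 formula against dw / w turns its constant into the term linear
  in Ln w. The values at w = 1 cancel again.\<close>

lemma polylog_3_inversion:
  assumes f2: "is_polylog 2 f2" and f3: "is_polylog 3 f3" and w: "w \<in> - \<real>\<^sub>\<le>\<^sub>0"
  shows "f3 (- w) - f3 (- (1 / w)) = 2 * f2 (-1) * Ln w - Ln w ^ 3 / 6"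
proof -
  have f3': "is_polylog (Suc 2) f3" using f3 by (simp add: eval_nat_numeral)
  have "((\<lambda>w. f3 (- w) - f3 (- (1 / w)) - 2 * f2 (-1) * Ln w + Ln w ^ 3 / 6)
           has_field_derivative 0) (at w)"
    if w: "w \<in> - \<real>\<^sub>\<le>\<^sub>0" for w
  proof -
    have "f2 (- w) / w - - (f2 (- (1 / w)) / w) - 2 * f2 (-1) / w + Ln w ^ 2 / (2 * w) = 0"
      using arg_cong[OF polylog_2_inversion[OF f2 w], of "\<lambda>x. x / w"]
        uminus_slit_plane_subset_cut_plane(3)[OF w]
      by (simp add: field_simps)
    moreover have "((\<lambda>w. Ln w ^ 3 / 6) has_field_derivative Ln w ^ 2 / (2 * w)) (at w)"
      using w by (auto intro!: derivative_eq_intros simp: field_simps)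
    ultimately show ?thesis using w
      by (auto intro!: derivative_eq_intros polylog_uminus_has_field_derivative[OF w f2 f3']
          polylog_uminus_inverse_has_field_derivative[OF w f2 f3'] simp: inverse_eq_divide)
  qed
  from slit_plane_constant[OF this w] show ?thesis by (simp add: algebra_simps)
qed

subsection \<open>Absolutely convergent integrals\<close>

text \<open>Absolute integrability is carried along with the value because the change of variables
  theorem is stated for it and it passes to subintervals.\<close>

definition has_abs_integral :: "(real \<Rightarrow> real) \<Rightarrow> real set \<Rightarrow> real \<Rightarrow> bool"
  where "has_abs_integral f S b \<longleftrightarrow> f absolutely_integrable_on S \<and> integral S f = b"

lemma has_abs_integral_cong:
  assumes "\<And>t. t \<in> S \<Longrightarrow> f t = g t"
  shows "has_abs_integral f S b \<longleftrightarrow> has_abs_integral g S b"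
  using set_integrable_cong[OF refl refl, of S f g lebesgue] integral_cong[of S f g] assms
  by (auto simp: has_abs_integral_def)

lemma has_abs_integral_unique: "has_abs_integral f S a \<Longrightarrow> has_abs_integral f S b \<Longrightarrow> a = b"
  by (simp add: has_abs_integral_def)

lemma has_abs_integral_imp_has_integral: "has_abs_integral f S b \<Longrightarrow> (f has_integral b) S"
  using set_lebesgue_integral_eq_integral(1) unfolding has_abs_integral_def
  by (auto simp: has_integral_integrable_integral)

lemma has_abs_integral_add:
  assumes "has_abs_integral f S a" "has_abs_integral g S b"
  shows "has_abs_integral (\<lambda>t. f t + g t) S (a + b)"
  using assms set_integral_add(1)[of lebesgue S f g]
    has_integral_add[OF assms[THEN has_abs_integral_imp_has_integral]]
  by (auto simp: has_abs_integral_def)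

lemma has_abs_integral_cmult:
  assumes "has_abs_integral f S a"
  shows "has_abs_integral (\<lambda>t. c * f t) S (c * a)"
  using assms by (auto simp: has_abs_integral_def)

text \<open>For a nonnegative integrand, gauge integrability is already absolute. This upgrades
  results of the fundamental theorem of calculus, and the open interval drops the logarithmic
  singularities at the endpoints.\<close>

lemma has_abs_integral_nonneg:
  assumes "(f has_integral b) {x..y}" "\<And>t. t \<in> {x<..<y} \<Longrightarrow> 0 \<le> f t"
  shows "has_abs_integral f {x<..<y} b"
proof -
  have "(f has_integral b) {x<..<y}" using assms(1) has_integral_Icc_iff_Ioo by blast
  thus ?thesis
    using nonnegative_absolutely_integrable_1[of f "{x<..<y}"] assms(2)
    by (auto simp: has_abs_integral_def integrable_on_def)
qed

lemma has_abs_integral_continuous: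
  assumes "continuous_on {x..y} f" "(f has_integral b) {x..y}"
  shows "has_abs_integral f {x<..<y} b"
proof -
  have "f absolutely_integrable_on {x..y}"
    using assms(1) absolutely_integrable_continuous_real by blast
  hence "f absolutely_integrable_on {x<..<y}"
    by (rule set_integrable_subset) auto
  moreover have "(f has_integral b) {x<..<y}" using assms(2) has_integral_Icc_iff_Ioo by blast
  ultimately show ?thesis by (auto simp: has_abs_integral_def)
qed

lemma has_abs_integral_change_of_variables:
  assumes "\<And>t. t \<in> {x<..<y} \<Longrightarrow> (g has_real_derivative g' t) (at t)"
    and "inj_on g {x<..<y}" and "g ` {x<..<y} = T"
  shows "has_abs_integral f T b \<longleftrightarrow> has_abs_integral (\<lambda>t. \<bar>g' t\<bar> * f (g t)) {x<..<y} b"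
proof -
  have "(g has_field_derivative g' t) (at t within {x<..<y})" if "t \<in> {x<..<y}" for t
    using assms(1)[OF that] by (rule has_field_derivative_at_within)
  from has_absolute_integral_change_of_variables_1'[OF _ this assms(2), of f b] assms(3)
  show ?thesis by (simp add: has_abs_integral_def)
qed

lemma has_abs_integral_split:
  assumes "has_abs_integral f {x<..<y} a" "has_abs_integral f {y<..<z} b" "x < y" "y < z"
  shows "has_abs_integral f {x<..<z} (a + b)"
proof -
  have eq: "{x<..<z} = ({x<..<y} \<union> {y<..<z}) \<union> {y}" using assms(3,4) by auto
  have disj: "{x<..<y} \<inter> {y<..<z} = {}" "({x<..<y} \<union> {y<..<z}) \<inter> {y} = {}" by auto
  have pt: "f absolutely_integrable_on {y}" "(f has_integral 0) {y}"
    using has_integral_refl(2)[of f y] has_integral_refl(2)[of "\<lambda>t. \<bar>f t\<bar>" y]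
    by (auto simp: absolutely_integrable_on_def integrable_on_def)
  have "f absolutely_integrable_on {x<..<z}"
    unfolding eq using assms(1,2) pt by (intro set_integrable_Un) (auto simp: has_abs_integral_def)
  moreover have "(f has_integral a + b + 0) {x<..<z}"
    unfolding eq
    using assms(1,2)[THEN has_abs_integral_imp_has_integral] pt
    by (intro has_integral_Un) (simp_all add: disj)
  ultimately show ?thesis by (auto simp: has_abs_integral_def)
qed

section \<open>Integrals against d arctan t over (0, 1), the angle brackets of the overview\<close>

definition has_arctan_integral :: "(real \<Rightarrow> real) \<Rightarrow> real \<Rightarrow> bool"
  where "has_arctan_integral f b \<longleftrightarrow> has_abs_integral (\<lambda>t. f t / (1 + t\<^sup>2)) {0<..<1} b"

lemma has_arctan_integral_unique:
  "has_arctan_integral f a \<Longrightarrow> has_arctan_integral f b \<Longrightarrow> a = b"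
  unfolding has_arctan_integral_def by (rule has_abs_integral_unique)

lemma has_arctan_integral_cong:
  assumes "\<And>t. t \<in> {0<..<1} \<Longrightarrow> f t = g t"
  shows "has_arctan_integral f b \<longleftrightarrow> has_arctan_integral g b"
  unfolding has_arctan_integral_def by (rule has_abs_integral_cong) (simp add: assms)

lemma has_arctan_integral_add:
  "has_arctan_integral f a \<Longrightarrow> has_arctan_integral g b \<Longrightarrow> has_arctan_integral (\<lambda>t. f t + g t) (a + b)"
  unfolding has_arctan_integral_def
  by (drule (1) has_abs_integral_add) (simp add: add_divide_distrib)

lemma has_arctan_integral_cmult:
  "has_arctan_integral f a \<Longrightarrow> has_arctan_integral (\<lambda>t. c * f t) (c * a)"
  unfolding has_arctan_integral_def by (drule has_abs_integral_cmult[of _ _ _ c]) simp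

lemma has_arctan_integral_one: "has_arctan_integral (\<lambda>_. 1) (pi / 4)"
proof -
  have "((\<lambda>t. 1 / (1 + t\<^sup>2)) has_integral arctan 1 - arctan 0) {0..1::real}"
    by (intro fundamental_theorem_of_calculus)
       (auto intro!: derivative_eq_intros simp: has_real_derivative_iff_has_vector_derivative[symmetric]
          inverse_eq_divide)
  thus ?thesis unfolding has_arctan_integral_def
    by (intro has_abs_integral_nonneg) (auto simp: arctan_one)
qed

text \<open>The involution \<open>(1 - t) / (1 + t)\<close> is \<open>tan (\<pi>/4 - arctan t)\<close>, hence preserves \<open>d arctan\<close>.\<close>

lemma has_arctan_integral_reflect:
  "has_arctan_integral f b \<longleftrightarrow> has_arctan_integral (\<lambda>t. f ((1 - t) / (1 + t))) b"
proof -
  let ?g = "\<lambda>t::real. (1 - t) / (1 + t)"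
  have inv: "?g (?g t) = t" "?g t \<in> {0<..<1}" if "t \<in> {0<..<1}" for t
    using that by (auto simp: divide_simps)
  have "has_arctan_integral f b \<longleftrightarrow>
      has_abs_integral (\<lambda>t. \<bar>- (2 / (1 + t)\<^sup>2)\<bar> * (f (?g t) / (1 + (?g t)\<^sup>2))) {0<..<1} b"
    unfolding has_arctan_integral_def
  proof (rule has_abs_integral_change_of_variables)
    show "inj_on ?g {0<..<1}" by (rule inj_on_inverseI[of _ ?g]) (rule inv)
    show "?g ` {0<..<1} = {0<..<1}"
      using inv by (auto simp: image_iff) (metis greaterThanLessThan_iff inv)
    show "(?g has_real_derivative - (2 / (1 + t)\<^sup>2)) (at t)" if "t \<in> {0<..<1}" for t
      using that by (auto intro!: derivative_eq_intros simp: field_simps power2_eq_square)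
  qed
  also have "\<dots> \<longleftrightarrow> has_arctan_integral (\<lambda>t. f (?g t)) b"
    unfolding has_arctan_integral_def
  proof (rule has_abs_integral_cong)
    fix t :: real assume t: "t \<in> {0<..<1}"
    have "(1 + t)\<^sup>2 * (1 + (?g t)\<^sup>2) = (1 + t)\<^sup>2 + (1 - t)\<^sup>2"
      using t by (simp add: distrib_left power_divide)
    also have "\<dots> = 2 * (1 + t\<^sup>2)" by (simp add: power2_eq_square algebra_simps)
    finally have eq: "(1 + t)\<^sup>2 * (1 + (?g t)\<^sup>2) = 2 * (1 + t\<^sup>2)" .
    have "\<bar>- (2 / (1 + t)\<^sup>2)\<bar> * (f (?g t) / (1 + (?g t)\<^sup>2)) = 2 * f (?g t) / ((1 + t)\<^sup>2 * (1 + (?g t)\<^sup>2))"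
      by simp
    also have "\<dots> = f (?g t) / (1 + t\<^sup>2)" unfolding eq by (rule mult_divide_mult_cancel_left) simp
    finally show "\<bar>- (2 / (1 + t)\<^sup>2)\<bar> * (f (?g t) / (1 + (?g t)\<^sup>2)) = f (?g t) / (1 + t\<^sup>2)" .
  qed
  finally show ?thesis .
qed

text \<open>Makes the mixed products of logarithms integrable through |f g| \<le> f^2 + g^2. Their
  values remain unknowns of the linear system, so existence is all that is asked.\<close>

lemma has_arctan_integral_mult:
  assumes "has_arctan_integral (\<lambda>t. (f t)\<^sup>2) a" "has_arctan_integral (\<lambda>t. (g t)\<^sup>2) b"
    and [measurable]: "f \<in> borel_measurable borel" "g \<in> borel_measurable borel"
  shows "\<exists>c. has_arctan_integral (\<lambda>t. f t * g t) c"
proof -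
  have "has_arctan_integral (\<lambda>t. (f t)\<^sup>2 + (g t)\<^sup>2) (a + b)"
    by (rule has_arctan_integral_add[OF assms(1,2)])
  hence int: "(\<lambda>t. ((f t)\<^sup>2 + (g t)\<^sup>2) / (1 + t\<^sup>2)) integrable_on {0<..<1}"
    using has_abs_integral_imp_has_integral unfolding has_arctan_integral_def by blast
  have "(\<lambda>t. f t * g t / (1 + t\<^sup>2)) absolutely_integrable_on {0<..<1}"
  proof (rule measurable_bounded_by_integrable_imp_absolutely_integrable[OF _ _ int])
    have "(\<lambda>t. f t * g t / (1 + t\<^sup>2)) \<in> borel_measurable borel" by measurable
    hence "(\<lambda>t. f t * g t / (1 + t\<^sup>2)) \<in> borel_measurable lebesgue"
      by (intro measurable_completion) simp
    thus "(\<lambda>t. f t * g t / (1 + t\<^sup>2)) \<in> borel_measurable (lebesgue_on {0<..<1})"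
      by (rule measurable_restrict_space1)
    fix t :: real
    have "\<bar>f t * g t\<bar> \<le> (f t)\<^sup>2 + (g t)\<^sup>2"
      using sum_squares_bound[of "\<bar>f t\<bar>" "\<bar>g t\<bar>"] abs_ge_zero[of "f t * g t"]
      unfolding abs_mult power2_abs by linarith
    thus "norm (f t * g t / (1 + t\<^sup>2)) \<le> ((f t)\<^sup>2 + (g t)\<^sup>2) / (1 + t\<^sup>2)"
      by (simp add: abs_divide divide_right_mono)
  qed simp
  thus ?thesis by (auto simp: has_arctan_integral_def has_abs_integral_def)
qed

subsection \<open>Logarithmic integrals of power series\<close>

lemma continuous_on_mult_ln: "continuous_on {0..} (\<lambda>t::real. t * ln t)"
proof -
  have "continuous (at t within {0..}) (\<lambda>t::real. t * ln t)" if "t \<ge> 0" for t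
  proof (cases "t = 0")
    case True
    have "((\<lambda>t::real. t * ln t) \<longlongrightarrow> 0) (at_right 0)"
      using tendsto_mult_ln_power_at_right_0[of 1] by simp
    thus ?thesis using True by (simp add: continuous_within at_within_Ici_at_right)
  next
    case False
    hence "isCont (\<lambda>t::real. t * ln t) t" by (intro isCont_mult continuous_ident isCont_ln)
    thus ?thesis by (rule continuous_at_imp_continuous_at_within)
  qed
  thus ?thesis by (simp add: continuous_on_eq_continuous_within)
qed

lemma has_abs_integral_ln_power:
  "has_abs_integral (\<lambda>t. - ln t * t ^ n) {0<..<1} (1 / (real n + 1)\<^sup>2)"
proof (rule has_abs_integral_nonneg)
  define m where "m = real n + 1"
  \<comment> \<open>Grouping t ln t as one factor makes continuity at 0 visible even when n =
    0.\<close>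
  define H where "H t = t ^ Suc n / m\<^sup>2 - t ^ n * (t * ln t) / m" for t :: real
  have m: "m \<noteq> 0" by (simp add: m_def)
  have "((\<lambda>t. - ln t * t ^ n) has_integral H 1 - H 0) {0..1}"
  proof (rule fundamental_theorem_of_calculus_interior)
    show "continuous_on {0..1} H" unfolding H_def using m
      by (intro continuous_on_diff continuous_on_divide continuous_on_mult continuous_on_power
            continuous_on_id continuous_on_const continuous_on_subset[OF continuous_on_mult_ln]) auto
    fix t :: real assume t: "t \<in> {0<..<1}"
    have pw: "((\<lambda>t. t ^ Suc n) has_real_derivative m * t ^ n) (at t)"
      unfolding m_def using DERIV_pow[of "Suc n" t] by (simp add: add_ac)
    moreover have "((\<lambda>t. t ^ Suc n * ln t) has_real_derivative m * t ^ n * ln t + t ^ n) (at t)"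
      using DERIV_mult[OF pw DERIV_ln_divide[of t]] t by simp
    ultimately have "((\<lambda>t. t ^ Suc n / m\<^sup>2 - t ^ Suc n * ln t / m) has_real_derivative
        m * t ^ n / m\<^sup>2 - (m * t ^ n * ln t + t ^ n) / m) (at t)"
      by (intro DERIV_diff DERIV_cdivide)
    also have "m * t ^ n / m\<^sup>2 - (m * t ^ n * ln t + t ^ n) / m = - ln t * t ^ n"
      using m by (simp add: power2_eq_square field_simps)
    also have "(\<lambda>t. t ^ Suc n / m\<^sup>2 - t ^ Suc n * ln t / m) = H" by (simp add: H_def fun_eq_iff mult_ac)
    finally show "(H has_vector_derivative - ln t * t ^ n) (at t)"
      by (simp add: has_real_derivative_iff_has_vector_derivative)
  qed simp
  thus "((\<lambda>t. - ln t * t ^ n) has_integral 1 / (real n + 1)\<^sup>2) {0..1}" by (simp add: H_def m_def)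
qed (auto intro!: mult_nonpos_nonneg)

text \<open>Termwise integration. Since - ln t is positive on (0, 1), the k-th term has L1 norm |c
  k| / (e k + 1)^2, so the first assumption is the summability of norms that
  \<open>integrable_suminf\<close> asks for.\<close>

lemma has_abs_integral_ln_power_series:
  fixes c :: "nat \<Rightarrow> real" and e :: "nat \<Rightarrow> nat"
  assumes summable: "summable (\<lambda>k. \<bar>c k\<bar> / (real (e k) + 1)\<^sup>2)"
    and abs_conv: "\<And>t. t \<in> {0<..<1} \<Longrightarrow> summable (\<lambda>k. \<bar>c k\<bar> * t ^ e k)"
    and sums: "\<And>t. t \<in> {0<..<1} \<Longrightarrow> (\<lambda>k. c k * t ^ e k) sums f t"
  shows "has_abs_integral (\<lambda>t. - ln t * f t) {0<..<1} (\<Sum>k. c k / (real (e k) + 1)\<^sup>2)"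
proof -
  \<comment> \<open>Extension by zero puts the terms on the whole line, where the series theorem for
    the Lebesgue integral applies.\<close>
  define g where "g k t = indicator {0<..<1} t *\<^sub>R (c k * (- ln t * t ^ e k))" for k and t :: real
  note int_k = has_abs_integral_cmult[OF has_abs_integral_ln_power]
  have g_eq: "g k = (\<lambda>t. indicator {0<..<1} t *\<^sub>R (c k * (- ln t * t ^ e k)))" for k
    by (simp add: g_def fun_eq_iff)
  have abs_int: "(\<lambda>t. d * (- ln t * t ^ e k)) absolutely_integrable_on {0<..<1}"
    and val: "integral {0<..<1} (\<lambda>t. d * (- ln t * t ^ e k)) = d * (1 / (real (e k) + 1)\<^sup>2)" for d k
    using int_k[of d "e k"] unfolding has_abs_integral_def by (rule conjunct1, rule conjunct2)
  have g_int: "integrable lebesgue (g k)" for k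
    using abs_int[of "c k" k] unfolding set_integrable_def g_eq .
  have leb_val: "(\<integral>t. indicator {0<..<1} t *\<^sub>R (d * (- ln t * t ^ e k)) \<partial>lebesgue) = d / (real (e k) + 1)\<^sup>2" for d k
    using set_lebesgue_integral_eq_integral(2)[OF abs_int[of d k]]
    unfolding set_lebesgue_integral_def val by simp
  have g_val: "integral\<^sup>L lebesgue (g k) = c k / (real (e k) + 1)\<^sup>2" for k
    unfolding g_eq by (rule leb_val)
  have norm_g: "norm (g k t) = indicator {0<..<1} t *\<^sub>R (\<bar>c k\<bar> * (- ln t * t ^ e k))" for k t
    by (auto simp: g_def indicator_def abs_mult)
  have norm_val: "(\<integral>t. norm (g k t) \<partial>lebesgue) = \<bar>c k\<bar> / (real (e k) + 1)\<^sup>2" for k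
    unfolding norm_g by (rule leb_val)
  have ae: "AE t in lebesgue. summable (\<lambda>k. norm (g k t))"
  proof (rule AE_I2)
    fix t :: real
    show "summable (\<lambda>k. norm (g k t))"
    proof (cases "t \<in> {0<..<1}")
      case True
      thus ?thesis using summable_mult[OF abs_conv[OF True], of "- ln t"]
        unfolding norm_g by (simp add: mult_ac)
    next
      case False
      hence "norm (g k t) = 0" for k by (auto simp: g_def indicator_def)
      thus ?thesis by simp
    qed
  qed
  have sumg: "(\<Sum>k. g k t) = indicator {0<..<1} t *\<^sub>R (- ln t * f t)" for t
    using sums_unique[OF sums_mult[OF sums[of t], of "- ln t"]]
    by (auto simp: g_def indicator_def mult_ac)
  have conv: "summable (\<lambda>k. \<integral>t. norm (g k t) \<partial>lebesgue)"
    unfolding norm_val by (rule summable)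
  have "integrable lebesgue (\<lambda>t. \<Sum>k. g k t)"
    by (rule integrable_suminf[OF g_int ae conv])
  hence int: "(\<lambda>t. - ln t * f t) absolutely_integrable_on {0<..<1}"
    unfolding sumg set_integrable_def .
  have "(\<integral>t. (\<Sum>k. g k t) \<partial>lebesgue) = (\<Sum>k. c k / (real (e k) + 1)\<^sup>2)"
    using integral_suminf[OF g_int ae conv] by (simp only: g_val)
  hence "integral {0<..<1} (\<lambda>t. - ln t * f t) = (\<Sum>k. c k / (real (e k) + 1)\<^sup>2)"
    using set_lebesgue_integral_eq_integral(2)[OF int] unfolding sumg set_lebesgue_integral_def by simp
  with int show ?thesis by (simp add: has_abs_integral_def)
qed

lemma alternating_geometric_sums:
  fixes t :: real
  assumes "t \<in> {0<..<1}" "a > 0"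
  shows "summable (\<lambda>k. \<bar>(-1) ^ k\<bar> * t ^ (a * k + r))"
    and "(\<lambda>k. (-1) ^ k * t ^ (a * k + r)) sums (t ^ r / (1 + t ^ a))"
proof -
  have ta: "t ^ a < 1" "0 < t ^ a" using assms by (auto simp: power_less_one_iff)
  have "summable (\<lambda>k. t ^ r * (t ^ a) ^ k)"
    using ta by (intro summable_mult summable_geometric) auto
  moreover have "\<bar>(-1) ^ k\<bar> * t ^ (a * k + r) = t ^ r * (t ^ a) ^ k" for k
    by (simp add: power_add power_mult power_abs)
  ultimately show "summable (\<lambda>k. \<bar>(-1) ^ k\<bar> * t ^ (a * k + r))" by simp
  have "(\<lambda>k. t ^ r * (- (t ^ a)) ^ k) sums (t ^ r * (1 / (1 - - (t ^ a))))"
    using ta by (intro sums_mult geometric_sums) auto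
  moreover have "t ^ r * (- (t ^ a)) ^ k = (-1) ^ k * t ^ (a * k + r)" for k
    by (simp add: power_add power_mult power_minus[of "t ^ a"] mult_ac)
  ultimately show "(\<lambda>k. (-1) ^ k * t ^ (a * k + r)) sums (t ^ r / (1 + t ^ a))"
    by simp
qed

text \<open>Covers three later series at once: (a, r) = (1, 0) for Li_2(-1), (2, 0) for Catalan's
  constant, and (2, 1) for the integral of - t ln t against d arctan t.\<close>

lemma has_abs_integral_ln_over_one_plus_power:
  assumes a: "a > 0"
  shows "has_abs_integral (\<lambda>t. - ln t * (t ^ r / (1 + t ^ a))) {0<..<1}
           (\<Sum>k. (-1) ^ k / (real (a * k + r) + 1)\<^sup>2)"
proof (rule has_abs_integral_ln_power_series)
  show "summable (\<lambda>k. \<bar>(-1) ^ k\<bar> / (real (a * k + r) + 1)\<^sup>2)"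
  proof (rule summable_comparison_test')
    show "summable (\<lambda>k. 1 / (real k + 1)\<^sup>2)" using inverse_squares_sums by (simp add: sums_iff add_ac)
    fix k :: nat
    have "k \<le> a * k + r" using a by (cases a) auto
    hence "real k + 1 \<le> real (a * k + r) + 1" by linarith
    hence "1 / (real (a * k + r) + 1)\<^sup>2 \<le> 1 / (real k + 1)\<^sup>2"
      by (intro frac_le power_mono) auto
    thus "norm (\<bar>(-1) ^ k\<bar> / (real (a * k + r) + 1)\<^sup>2) \<le> 1 / (real k + 1)\<^sup>2"
      by (simp add: power_abs)
  qed
qed (rule alternating_geometric_sums[OF _ a], assumption)+

lemma alternating_inverse_squares_sum: "(\<Sum>k. (-1) ^ k / (real k + 1)\<^sup>2) = pi\<^sup>2 / 12"
proof -
  let ?f = "\<lambda>k. 1 / (real k + 1)\<^sup>2"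
  have z: "?f sums (pi\<^sup>2 / 6)" using inverse_squares_sums by (simp add: add_ac)
  have "(\<lambda>k. 1/2 * ?f k) sums (1/2 * (pi\<^sup>2 / 6))" by (intro sums_mult z)
  \<comment> \<open>The index is shifted by one, so odd k are the even denominators. Twice their
    contribution is half of zeta(2), and subtracting it flips exactly these signs.\<close>
  moreover have "(\<lambda>k. if even k then 0 else 2 * ?f k) sums (1/2 * (pi\<^sup>2 / 6))"
  proof -
    have "(\<lambda>k. (1/2 * ?f k)) sums (1/2 * (pi\<^sup>2 / 6))" by fact
    moreover have "1/2 * ?f k = 2 * ?f (2 * k + 1)" for k
      by (simp add: power2_eq_square divide_simps) (simp add: algebra_simps)
    ultimately have sums_odd: "(\<lambda>k. 2 * ?f (2 * k + 1)) sums (1/2 * (pi\<^sup>2 / 6))" by simp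
    have "strict_mono (\<lambda>k::nat. 2 * k + 1)" by (simp add: strict_mono_def)
    moreover have "(if even n then 0 else 2 * ?f n) = 0" if "n \<notin> range (\<lambda>k. 2 * k + 1)" for n
      using that by (metis oddE rangeI)
    ultimately have "(\<lambda>k. if even (2 * k + 1) then 0 else 2 * ?f (2 * k + 1)) sums (1/2 * (pi\<^sup>2 / 6)) \<longleftrightarrow>
        (\<lambda>k. if even k then 0 else 2 * ?f k) sums (1/2 * (pi\<^sup>2 / 6))"
      by (intro sums_mono_reindex)
    thus ?thesis using sums_odd by simp
  qed
  ultimately have "(\<lambda>k. ?f k - (if even k then 0 else 2 * ?f k)) sums (pi\<^sup>2 / 6 - 1/2 * (pi\<^sup>2 / 6))"
    using z sums_diff by blast
  moreover have "?f k - (if even k then 0 else 2 * ?f k) = (-1) ^ k / (real k + 1)\<^sup>2" for k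
    by auto
  ultimately show ?thesis by (simp add: sums_iff)
qed

subsection \<open>Trilogarithm values as integrals\<close>

text \<open>At z = -1 the kernel is -1 / (1 + t), so the integral representation meets the
  alternating series of inverse squares.\<close>

lemma polylog_2_minus_one: assumes f: "is_polylog 2 f" shows "f (-1) = - of_real (pi\<^sup>2) / 12"
proof -
  have m1: "-1 \<in> cut_plane" by (rule cut_planeI) simp
  have "has_abs_integral (\<lambda>t. - ln t * (t ^ 0 / (1 + t ^ 1))) {0<..<1} (\<Sum>k. (-1) ^ k / (real (1 * k + 0) + 1)\<^sup>2)"
    by (rule has_abs_integral_ln_over_one_plus_power) simp
  hence "has_abs_integral (\<lambda>t. - ln t * (1 / (1 + t))) {0<..<1} (pi\<^sup>2 / 12)"
    using alternating_inverse_squares_sum by simp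
  hence "((\<lambda>t. - ln t * (1 / (1 + t))) has_integral pi\<^sup>2 / 12) {0<..<1}"
    by (rule has_abs_integral_imp_has_integral)
  hence "((\<lambda>t. - ln t * (1 / (1 + t))) has_integral pi\<^sup>2 / 12) {0..1}"
    by (simp only: has_integral_Icc_iff_Ioo)
  from has_integral_linear[OF this bounded_linear_of_real[where 'a = complex]]
  have "((\<lambda>t. of_real (- ln t * (1 / (1 + t))) :: complex) has_integral of_real (pi\<^sup>2 / 12)) {0..1}"
    by (simp only: o_def)
  moreover have "((\<lambda>t. of_real (ln t) * (-1 / (1 - of_real t * -1))) has_integral - f (-1)) {0..1}"
    by (rule has_integral_ln_polylog_kernel[OF f m1])
  moreover have "(\<lambda>t. of_real (ln t) * (-1 / (1 - of_real t * -1)))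
      = (\<lambda>t. of_real (- ln t * (1 / (1 + t))) :: complex)"
    by (rule ext) simp
  ultimately have "complex_of_real (pi\<^sup>2 / 12) = - f (-1)"
    using has_integral_unique by metis
  hence "f (-1) = - complex_of_real (pi\<^sup>2 / 12)" by simp
  thus ?thesis by simp
qed

text \<open>The denominator is |1 - t z|^2, as Im (z / (1 - t z)) = Im z / |1 - t z|^2. Dividing by
  Im z leaves a nonnegative integrand, so absolute integrability comes for free.\<close>

lemma has_abs_integral_ln_squared_quadratic:
  assumes f: "is_polylog 3 f" and z: "z \<in> cut_plane" and Im: "Im z \<noteq> 0"
  shows "has_abs_integral (\<lambda>t. (ln t)\<^sup>2 / ((1 - t * Re z)\<^sup>2 + (t * Im z)\<^sup>2)) {0<..<1} (2 * Im (f z) / Im z)"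
proof (rule has_abs_integral_nonneg)
  let ?k = "\<lambda>t. of_real ((ln t)\<^sup>2) * (z / (1 - of_real t * z))"
  have eq: "Im (?k t) / Im z = (ln t)\<^sup>2 / ((1 - t * Re z)\<^sup>2 + (t * Im z)\<^sup>2)" for t
  proof -
    have "Im (z / (1 - of_real t * z)) = Im z / ((1 - t * Re z)\<^sup>2 + (t * Im z)\<^sup>2)"
      by (simp add: Im_divide algebra_simps)
    moreover have "Im (?k t) = (ln t)\<^sup>2 * Im (z / (1 - of_real t * z))"
      by (simp only: scaleR_conv_of_real[symmetric] scaleR_complex.sel)
    ultimately show ?thesis using Im by simp
  qed
  have "((Im \<circ> ?k) has_integral Im (2 * f z)) {0..1}"
    by (rule has_integral_linear[OF has_integral_ln_squared_polylog_kernel[OF f z] bounded_linear_Im])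
  from has_integral_divide[OF this, of "Im z"]
  show "((\<lambda>t. (ln t)\<^sup>2 / ((1 - t * Re z)\<^sup>2 + (t * Im z)\<^sup>2)) has_integral 2 * Im (f z) / Im z) {0..1}"
    unfolding o_def eq by simp
qed simp

text \<open>Folds \<open>(1/2, 1)\<close> and \<open>(0, 1/2)\<close> onto \<open>(0, 1)\<close> by \<open>v = (1 - t) / t\<close> and its inverse.\<close>

lemma has_abs_integral_fold:
  assumes f: "has_abs_integral f {0<..<1} b"
  shows "has_abs_integral (\<lambda>v. (f (1 / (1 + v)) + f (v / (1 + v))) / (1 + v)\<^sup>2) {0<..<1} b"
proof -
  define b1 where "b1 = integral {1/2<..<1} f"
  define b2 where "b2 = integral {0<..<1/2} f"
  have "f absolutely_integrable_on {1/2<..<1}" "f absolutely_integrable_on {0<..<1/2}"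
    using f unfolding has_abs_integral_def by (auto elim: set_integrable_subset)
  hence b1: "has_abs_integral f {1/2<..<1} b1" and b2: "has_abs_integral f {0<..<1/2} b2"
    by (simp_all add: has_abs_integral_def b1_def b2_def)
  have "b = b2 + b1"
    by (rule has_abs_integral_unique[OF f has_abs_integral_split[OF b2 b1]]) auto
  moreover have "has_abs_integral (\<lambda>v. \<bar>- (1 / (1 + v)\<^sup>2)\<bar> * f (1 / (1 + v))) {0<..<1} b1"
  proof (rule iffD1[OF has_abs_integral_change_of_variables b1])
    show "((\<lambda>v. 1 / (1 + v)) has_real_derivative - (1 / (1 + v)\<^sup>2)) (at v)" if "v \<in> {0<..<1}" for v :: real
      using that by (auto intro!: derivative_eq_intros simp: power2_eq_square)
    show "inj_on (\<lambda>v::real. 1 / (1 + v)) {0<..<1}" by (auto simp: inj_on_def)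
    show "(\<lambda>v::real. 1 / (1 + v)) ` {0<..<1} = {1/2<..<1}"
    proof (intro set_eqI iffI)
      fix t :: real assume "t \<in> {1/2<..<1}"
      thus "t \<in> (\<lambda>v. 1 / (1 + v)) ` {0<..<1}"
        by (intro image_eqI[of _ _ "1 / t - 1"]) (auto simp: field_simps)
    qed (auto simp: field_simps)
  qed
  moreover have "has_abs_integral (\<lambda>v. \<bar>1 / (1 + v)\<^sup>2\<bar> * f (v / (1 + v))) {0<..<1} b2"
  proof (rule iffD1[OF has_abs_integral_change_of_variables b2])
    show "((\<lambda>v. v / (1 + v)) has_real_derivative 1 / (1 + v)\<^sup>2) (at v)" if "v \<in> {0<..<1}" for v :: real
      using that by (auto intro!: derivative_eq_intros simp: power2_eq_square field_simps)
    show "inj_on (\<lambda>v::real. v / (1 + v)) {0<..<1}" by (auto simp: inj_on_def field_simps)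
    show "(\<lambda>v::real. v / (1 + v)) ` {0<..<1} = {0<..<1/2}"
    proof (intro set_eqI iffI)
      fix t :: real assume "t \<in> {0<..<1/2}"
      thus "t \<in> (\<lambda>v. v / (1 + v)) ` {0<..<1}"
        by (intro image_eqI[of _ _ "t / (1 - t)"]) (auto simp: field_simps)
    qed (auto simp: field_simps)
  qed
  ultimately have "has_abs_integral (\<lambda>v. \<bar>1 / (1 + v)\<^sup>2\<bar> * f (v / (1 + v)) + \<bar>- (1 / (1 + v)\<^sup>2)\<bar> * f (1 / (1 + v))) {0<..<1} b"
    by (auto intro: has_abs_integral_add)
  thus ?thesis
    by (rule iffD1[OF has_abs_integral_cong, rotated]) (simp only: abs_minus_cancel abs_divide abs_one power_abs power2_abs add_divide_distrib mult_1_left times_divide_eq_left add.commute)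
qed

lemma one_plus_i_in_cut_plane: "1 + \<i> \<in> cut_plane"
  by (auto simp: cut_plane_def complex_eq_iff)

text \<open>The inversion formula at w = - z, which avoids the slit because Im z > 0; its
  coefficient 2 Li_2(-1) is - pi^2 / 6.\<close>

lemma polylog_3_Im_inversion:
  assumes f: "is_polylog 3 f" and z: "Im z > 0"
  shows "Im (f z) - Im (f (1 / z)) =
    Im (- (of_real (pi\<^sup>2) / 6) * Ln (- z) - Ln (- z) ^ 3 / 6)"
proof -
  obtain f2 where f2: "is_polylog 2 f2" using is_polylog_exists by blast
  have "- z \<in> - \<real>\<^sub>\<le>\<^sub>0" using z by (auto simp: complex_nonpos_Reals_iff)
  from polylog_3_inversion[OF f2 f this]
  have "f z - f (1 / z) = - (of_real (pi\<^sup>2) / 6) * Ln (- z) - Ln (- z) ^ 3 / 6"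
    by (simp add: polylog_2_minus_one[OF f2])
  thus ?thesis by (metis minus_complex.sel(2))
qed

lemma Im_cube: "Im (Complex a b ^ 3) = 3 * a\<^sup>2 * b - b ^ 3"
  by (simp add: power3_eq_cube power2_eq_square algebra_simps)

lemma Im_polylog_3_inversion_values:
  assumes f: "is_polylog 3 f"
  shows "2 * Im (f \<i>) = pi ^ 3 / 16"
    and "2 * Im (f (1 + \<i>)) - 2 * Im (f (1 / (1 + \<i>))) = 3 * pi * (ln 2)\<^sup>2 / 16 + 7 * pi ^ 3 / 64"
    and "2 * Im (f (-1 + \<i>)) - 2 * Im (f (1 / (-1 + \<i>))) = pi * (ln 2)\<^sup>2 / 16 + 5 * pi ^ 3 / 64"
proof -
  have value_eq: "Im (f z) - Im (f (1 / z)) = - (pi\<^sup>2 / 6) * b - (3 * a\<^sup>2 * b - b ^ 3) / 6"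
    if "Im z > 0" "Ln (- z) = Complex a b" for z a b
    unfolding polylog_3_Im_inversion[OF f that(1)] that(2) by (simp add: Im_cube)
  have ln_sqrt_2: "exp (ln 2 / 2 :: real) = sqrt 2" by (simp add: ln_sqrt[symmetric])
  have Ln1: "Ln (- \<i>) = Complex 0 (- pi / 2)" by (simp add: complex_eq_iff)
  have Ln2: "Ln (- (1 + \<i>)) = Complex (ln 2 / 2) (- (3 * pi / 4))"
  proof (rule Ln_unique)
    have "3 * pi / 4 = pi - pi / 4" by simp
    hence trig: "cos (3 * pi / 4) = - sqrt 2 / 2" "sin (3 * pi / 4) = sqrt 2 / 2"
      by (simp_all only: cos_pi_minus sin_pi_minus cos_45 sin_45)
    show "exp (Complex (ln 2 / 2) (- (3 * pi / 4))) = - (1 + \<i>)"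
      unfolding complex_eq_iff Re_exp Im_exp complex.sel ln_sqrt_2 cos_minus sin_minus trig by simp
  qed (use pi_gt_zero in \<open>simp_all add: field_simps\<close>)
  have Ln3: "Ln (- (-1 + \<i>)) = Complex (ln 2 / 2) (- (pi / 4))"
  proof (rule Ln_unique)
    show "exp (Complex (ln 2 / 2) (- (pi / 4))) = - (-1 + \<i>)"
      by (simp add: complex_eq_iff Re_exp Im_exp ln_sqrt_2 cos_45 sin_45)
  qed (use pi_gt_zero in \<open>simp_all add: field_simps\<close>)
  have cut: "\<i> \<in> cut_plane" "- \<i> \<in> cut_plane" by (auto intro: cut_planeI)
  \<comment> \<open>Since 1 / \<i> = - \<i> and the quadratic integrand is the same for both points,
    Im f(- \<i>) = - Im f(\<i>). The difference in the inversion formula thus becomes 2 Im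
    f(\<i>).\<close>
  have "2 * Im (f \<i>) / Im \<i> = 2 * Im (f (- \<i>)) / Im (- \<i>)"
    using has_abs_integral_ln_squared_quadratic[OF f cut(1)]
      has_abs_integral_ln_squared_quadratic[OF f cut(2)]
    by (intro has_abs_integral_unique[of "\<lambda>t. (ln t)\<^sup>2 / ((1 - t * Re \<i>)\<^sup>2 + (t * Im \<i>)\<^sup>2)" "{0<..<1}"]) auto
  thus "2 * Im (f \<i>) = pi ^ 3 / 16"
    using value_eq[OF _ Ln1] by (simp add: power_divide eval_nat_numeral)
  show "2 * Im (f (1 + \<i>)) - 2 * Im (f (1 / (1 + \<i>))) = 3 * pi * (ln 2)\<^sup>2 / 16 + 7 * pi ^ 3 / 64"
    using value_eq[OF _ Ln2] by (simp add: power_divide power2_eq_square power3_eq_cube field_simps)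
  show "2 * Im (f (-1 + \<i>)) - 2 * Im (f (1 / (-1 + \<i>))) = pi * (ln 2)\<^sup>2 / 16 + 5 * pi ^ 3 / 64"
    using value_eq[OF _ Ln3] by (simp add: power_divide power2_eq_square power3_eq_cube field_simps)
qed

subsection \<open>The linear system\<close>

lemma has_arctan_integral_ln: "has_arctan_integral ln (- catalan)"
proof -
  have "has_abs_integral (\<lambda>t. - ln t * (t ^ 0 / (1 + t ^ 2))) {0<..<1}
          (\<Sum>k. (-1) ^ k / (real (2 * k + 0) + 1)\<^sup>2)"
    by (rule has_abs_integral_ln_over_one_plus_power) simp
  hence "has_arctan_integral (\<lambda>t. - ln t) catalan"
    by (simp add: has_arctan_integral_def catalan_def)
  from has_arctan_integral_cmult[OF this, of "-1"] show ?thesis by simp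
qed

lemma has_arctan_integral_continuous:
  assumes "continuous_on {0..1} f" shows "\<exists>b. has_arctan_integral f b"
proof -
  have cont: "continuous_on {0..1} (\<lambda>t. f t / (1 + t\<^sup>2))"
    by (intro continuous_intros assms) (simp add: add_nonneg_eq_0_iff)
  obtain b where "((\<lambda>t. f t / (1 + t\<^sup>2)) has_integral b) {0..1}"
    using integrable_continuous_real[OF cont] by (auto simp: integrable_on_def)
  from has_abs_integral_continuous[OF cont this] show ?thesis
    by (auto simp: has_arctan_integral_def)
qed

lemma arctan_integral_log_products:
  assumes f: "is_polylog 3 f"
  shows "\<exists>a b. has_arctan_integral (\<lambda>t. ln t * ln (1 - t)) a \<and>
    has_arctan_integral (\<lambda>t. ln t * ln (1 + t)) b \<and>
    2 * a - 2 * b = pi / 2 * (ln 2)\<^sup>2 + pi ^ 3 / 4 + 4 * catalan * ln 2 - 8 * Im (f (1 + \<i>))"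
proof -
  have half: "1/2 * (x / d) = x / (2 * d)" for x d :: real by simp
  have inv1: "1 / (1 + \<i>) = Complex (1/2) (-1/2)" by (simp add: complex_eq_iff Re_divide Im_divide)
  have inv2: "1 / (-1 + \<i>) = Complex (-1/2) (-1/2)" by (simp add: complex_eq_iff Re_divide Im_divide)
  have "\<i> \<in> cut_plane" by (rule cut_planeI) simp
  from has_abs_integral_ln_squared_quadratic[OF f this]
  have ll: "has_arctan_integral (\<lambda>t. (ln t)\<^sup>2) (pi ^ 3 / 16)"
    using Im_polylog_3_inversion_values(1)[OF f] by (simp add: has_arctan_integral_def)
  define M where "M = - 2 * Im (f (1 / (1 + \<i>)))"
  have mm: "has_arctan_integral (\<lambda>t. (ln (1 - t))\<^sup>2) M"
  proof -
    \<comment> \<open>For z = (1 - \<i>) / 2 one has 2 |1 - t z|^2 = 1 + (1 - t)^2; the substitution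
      t -> 1 - t then yields the weight 1 / (1 + t^2).\<close>
    have "1 / (1 + \<i>) \<in> cut_plane" unfolding inv1 by (rule cut_planeI) simp
    from has_abs_integral_cmult[OF has_abs_integral_ln_squared_quadratic[OF f this], of "1/2"]
    have "has_abs_integral (\<lambda>t. 1/2 * ((ln t)\<^sup>2 / ((1 - t * (1/2))\<^sup>2 + (t * (-1/2))\<^sup>2))) {0<..<1} M"
      by (simp add: inv1 M_def)
    also have "(\<lambda>t::real. 1/2 * ((ln t)\<^sup>2 / ((1 - t * (1/2))\<^sup>2 + (t * (-1/2))\<^sup>2))) = (\<lambda>t. (ln t)\<^sup>2 / (1 + (1 - t)\<^sup>2))"
    proof (rule ext)
      fix t :: real
      have "2 * ((1 - t * (1/2))\<^sup>2 + (t * (-1/2))\<^sup>2) = 1 + (1 - t)\<^sup>2"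
        by (simp add: power2_eq_square field_simps)
      thus "1/2 * ((ln t)\<^sup>2 / ((1 - t * (1/2))\<^sup>2 + (t * (-1/2))\<^sup>2)) = (ln t)\<^sup>2 / (1 + (1 - t)\<^sup>2)"
        unfolding half by (simp only:)
    qed
    finally have "has_abs_integral (\<lambda>t. (ln t)\<^sup>2 / (1 + (1 - t)\<^sup>2)) {0<..<1} M" .
    moreover have "(\<lambda>t::real. 1 - t) ` {0<..<1} = {0<..<1}"
    proof (intro set_eqI iffI)
      fix t :: real assume "t \<in> {0<..<1}"
      thus "t \<in> (\<lambda>t. 1 - t) ` {0<..<1}" by (intro image_eqI[of _ _ "1 - t"]) auto
    qed auto
    ultimately have "has_abs_integral (\<lambda>t. \<bar>-1\<bar> * ((ln (1 - t))\<^sup>2 / (1 + (1 - (1 - t))\<^sup>2))) {0<..<1} M"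
      by (intro iffD1[OF has_abs_integral_change_of_variables[where g = "\<lambda>t. 1 - t" and g' = "\<lambda>_. -1"]])
         (auto intro!: derivative_eq_intros simp: inj_on_def)
    thus ?thesis by (simp add: has_arctan_integral_def)
  qed
  have cont: "continuous_on {0..1} (\<lambda>t::real. ln (1 + t))" by (intro continuous_intros) auto
  obtain v where p: "has_arctan_integral (\<lambda>t. ln (1 + t)) v"
    using has_arctan_integral_continuous[OF cont] by blast
  obtain P where pp: "has_arctan_integral (\<lambda>t. (ln (1 + t))\<^sup>2) P"
    using has_arctan_integral_continuous[OF continuous_on_power[OF cont]] by blast
  have meas: "(ln :: real \<Rightarrow> real) \<in> borel_measurable borel"
      "(\<lambda>t::real. ln (1 - t)) \<in> borel_measurable borel" "(\<lambda>t::real. ln (1 + t)) \<in> borel_measurable borel"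
    by measurable
  obtain a where lm: "has_arctan_integral (\<lambda>t. ln t * ln (1 - t)) a"
    using has_arctan_integral_mult[OF ll mm meas(1,2)] by blast
  obtain b where lp: "has_arctan_integral (\<lambda>t. ln t * ln (1 + t)) b"
    using has_arctan_integral_mult[OF ll pp meas(1,3)] by blast
  note lin = has_arctan_integral_add has_arctan_integral_cmult
  \<comment> \<open>The reflection sends ln (1 + t) to ln 2 - ln (1 + t), so this equation solves to
    v = pi ln 2 / 8.\<close>
  have v: "v = ln 2 * (pi / 4) + (-1) * v"
  proof (rule has_arctan_integral_unique[OF iffD1[OF has_arctan_integral_reflect p]])
    show "has_arctan_integral (\<lambda>t. ln (1 + (1 - t) / (1 + t))) (ln 2 * (pi / 4) + (-1) * v)"
    proof (rule iffD1[OF has_arctan_integral_cong])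
      show "has_arctan_integral (\<lambda>t. ln 2 * 1 + (-1) * ln (1 + t)) (ln 2 * (pi / 4) + (-1) * v)"
        by (intro lin has_arctan_integral_one p)
      fix t :: real assume t: "t \<in> {0<..<1}"
      have "1 + (1 - t) / (1 + t) = 2 / (1 + t)" using t by (simp add: field_simps)
      thus "ln 2 * 1 + (-1) * ln (1 + t) = ln (1 + (1 - t) / (1 + t))" using t by (simp add: ln_div)
    qed
  qed
  \<comment> \<open>The reflection sends ln (1 - t) to ln 2 + ln t - ln (1 + t). Expanding the
    square relates \<open>M\<close> to the unknowns \<open>P\<close> and \<open>b\<close>.\<close>
  have M: "M = (ln 2)\<^sup>2 * (pi / 4) + pi ^ 3 / 16 + P + (2 * ln 2) * (- catalan) + (- 2 * ln 2) * v + (-2) * b"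
    (is "M = ?m")
  proof (rule has_arctan_integral_unique[OF iffD1[OF has_arctan_integral_reflect mm]])
    show "has_arctan_integral (\<lambda>t. (ln (1 - (1 - t) / (1 + t)))\<^sup>2) ?m"
    proof (rule iffD1[OF has_arctan_integral_cong])
      show "has_arctan_integral (\<lambda>t. (ln 2)\<^sup>2 * 1 + (ln t)\<^sup>2 + (ln (1 + t))\<^sup>2 + (2 * ln 2) * ln t
        + (- 2 * ln 2) * ln (1 + t) + (-2) * (ln t * ln (1 + t))) ?m"
        by (intro lin has_arctan_integral_one has_arctan_integral_ln ll p pp lp)
      fix t :: real assume t: "t \<in> {0<..<1}"
      have "1 - (1 - t) / (1 + t) = 2 * t / (1 + t)" using t by (simp add: field_simps)
      hence lt: "ln (1 - (1 - t) / (1 + t)) = ln 2 + ln t - ln (1 + t)" using t by (simp add: ln_div ln_mult)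
      show "(ln 2)\<^sup>2 * 1 + (ln t)\<^sup>2 + (ln (1 + t))\<^sup>2 + (2 * ln 2) * ln t
        + (- 2 * ln 2) * ln (1 + t) + (-2) * (ln t * ln (1 + t)) = (ln (1 - (1 - t) / (1 + t)))\<^sup>2"
        unfolding lt by (simp add: power2_eq_square algebra_simps)
    qed
  qed
  \<comment> \<open>For z = 1 + \<i> the denominator (1 - t)^2 + t^2 is symmetric under t -> 1 - t,
    so both halves of the fold acquire the same weight 1 / (1 + v^2).\<close>
  have W: "2 * Im (f (1 + \<i>)) = 2 * P + pi ^ 3 / 16 + (-2) * b"
  proof (rule has_arctan_integral_unique)
    show "has_arctan_integral (\<lambda>t. 2 * (ln (1 + t))\<^sup>2 + (ln t)\<^sup>2 + (-2) * (ln t * ln (1 + t))) (2 * P + pi ^ 3 / 16 + (-2) * b)"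
      by (intro lin ll pp lp)
    have "has_abs_integral (\<lambda>t. (ln t)\<^sup>2 / ((1 - t)\<^sup>2 + t\<^sup>2)) {0<..<1} (2 * Im (f (1 + \<i>)))"
      using has_abs_integral_ln_squared_quadratic[OF f one_plus_i_in_cut_plane] by simp
    note folded = has_abs_integral_fold[OF this]
    show "has_arctan_integral (\<lambda>t. 2 * (ln (1 + t))\<^sup>2 + (ln t)\<^sup>2 + (-2) * (ln t * ln (1 + t))) (2 * Im (f (1 + \<i>)))"
      unfolding has_arctan_integral_def
    proof (rule iffD1[OF has_abs_integral_cong folded])
      fix t :: real assume "t \<in> {0<..<1}"
      define s where "s = 1 + t"
      have t: "t > 0" "s > 0" using \<open>t \<in> {0<..<1}\<close> by (auto simp: s_def)
      have r: "1 - 1 / s = t / s" "1 - t / s = 1 / s" using t by (simp_all add: s_def field_simps)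
      have l: "ln (1 / s) = - ln s" "ln (t / s) = ln t - ln s" using t by (simp_all add: ln_div)
      have q: "(t / s)\<^sup>2 + (1 / s)\<^sup>2 = (1 + t\<^sup>2) / s\<^sup>2" "(1 / s)\<^sup>2 + (t / s)\<^sup>2 = (1 + t\<^sup>2) / s\<^sup>2"
        by (simp_all add: power_divide add_divide_distrib)
      have "(a / (q / c) + b / (q / c)) / c = (a + b) / q" if "c \<noteq> 0" for a b c q :: real
        using that by (simp add: add_divide_distrib)
      hence "((ln s)\<^sup>2 / ((1 + t\<^sup>2) / s\<^sup>2) + (ln t - ln s)\<^sup>2 / ((1 + t\<^sup>2) / s\<^sup>2)) / s\<^sup>2
          = (2 * (ln s)\<^sup>2 + (ln t)\<^sup>2 + (-2) * (ln t * ln s)) / (1 + t\<^sup>2)"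
        using t by (simp add: power2_diff mult_ac)
      thus "((ln (1 / (1 + t)))\<^sup>2 / ((1 - 1 / (1 + t))\<^sup>2 + (1 / (1 + t))\<^sup>2) +
          (ln (t / (1 + t)))\<^sup>2 / ((1 - t / (1 + t))\<^sup>2 + (t / (1 + t))\<^sup>2)) / (1 + t)\<^sup>2
          = (2 * (ln (1 + t))\<^sup>2 + (ln t)\<^sup>2 + (-2) * (ln t * ln (1 + t))) / (1 + t\<^sup>2)"
        unfolding s_def[symmetric] r l q power2_minus .
    qed
  qed
  \<comment> \<open>Here the fold starts from the arctan integral of (ln (1 - t) - ln t)^2. Its two
    halves are the quadratic integrands of -1 + \<i> and of its inverse (-1 - \<i>) / 2, the latter
    with factor 1/2.\<close>
  have Ep: "2 * Im (f (-1 + \<i>)) - 2 * Im (f (1 / (-1 + \<i>))) = M + pi ^ 3 / 16 + (-2) * a"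
  proof -
    have "has_arctan_integral (\<lambda>t. (ln (1 - t))\<^sup>2 + (ln t)\<^sup>2 + (-2) * (ln t * ln (1 - t))) (M + pi ^ 3 / 16 + (-2) * a)"
      by (intro lin ll mm lm)
    hence "has_abs_integral (\<lambda>t. (ln (1 - t) - ln t)\<^sup>2 / (1 + t\<^sup>2)) {0<..<1} (M + pi ^ 3 / 16 + (-2) * a)"
      unfolding has_arctan_integral_def by (simp add: power2_eq_square algebra_simps)
    note folded = has_abs_integral_fold[OF this]
    have cut: "-1 + \<i> \<in> cut_plane" "1 / (-1 + \<i>) \<in> cut_plane" unfolding inv2 by (auto intro!: cut_planeI)
    have "has_abs_integral (\<lambda>t. (ln t)\<^sup>2 / ((1 + t)\<^sup>2 + t\<^sup>2) + (ln t)\<^sup>2 / (1 + (1 + t)\<^sup>2)) {0<..<1}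
       (2 * Im (f (-1 + \<i>)) + 1/2 * (2 * Im (f (1 / (-1 + \<i>))) / Im (1 / (-1 + \<i>))))"
    proof (rule iffD1[OF has_abs_integral_cong has_abs_integral_add])
      show "has_abs_integral (\<lambda>t. (ln t)\<^sup>2 / ((1 + t)\<^sup>2 + t\<^sup>2)) {0<..<1} (2 * Im (f (-1 + \<i>)))"
        using has_abs_integral_ln_squared_quadratic[OF f cut(1)] by simp
      show "has_abs_integral (\<lambda>t. 1/2 * ((ln t)\<^sup>2 / ((1 - t * Re (1 / (-1 + \<i>)))\<^sup>2 + (t * Im (1 / (-1 + \<i>)))\<^sup>2))) {0<..<1}
        (1/2 * (2 * Im (f (1 / (-1 + \<i>))) / Im (1 / (-1 + \<i>))))"
        by (rule has_abs_integral_cmult[OF has_abs_integral_ln_squared_quadratic[OF f cut(2)]]) (unfold inv2, simp)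
      show "(ln t)\<^sup>2 / ((1 + t)\<^sup>2 + t\<^sup>2) + 1/2 * ((ln t)\<^sup>2 / ((1 - t * Re (1 / (-1 + \<i>)))\<^sup>2 + (t * Im (1 / (-1 + \<i>)))\<^sup>2))
        = (ln t)\<^sup>2 / ((1 + t)\<^sup>2 + t\<^sup>2) + (ln t)\<^sup>2 / (1 + (1 + t)\<^sup>2)" for t :: real
      proof -
        have "2 * ((1 - t * (-1/2))\<^sup>2 + (t * (-1/2))\<^sup>2) = 1 + (1 + t)\<^sup>2"
          by (simp add: power2_eq_square field_simps)
        thus ?thesis unfolding inv2 complex.sel half by (simp only:)
      qed
    qed
    moreover have "has_abs_integral (\<lambda>t. (ln t)\<^sup>2 / ((1 + t)\<^sup>2 + t\<^sup>2) + (ln t)\<^sup>2 / (1 + (1 + t)\<^sup>2)) {0<..<1}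
       (M + pi ^ 3 / 16 + (-2) * a)"
    proof (rule iffD1[OF has_abs_integral_cong folded])
      fix t :: real assume "t \<in> {0<..<1}"
      define s where "s = 1 + t"
      have t: "t > 0" "s > 0" using \<open>t \<in> {0<..<1}\<close> by (auto simp: s_def)
      have r: "1 - 1 / s = t / s" "1 - t / s = 1 / s" using t by (simp_all add: s_def field_simps)
      have l: "ln (t / s) - ln (1 / s) = ln t" "ln (1 / s) - ln (t / s) = - ln t" using t by (simp_all add: ln_div)
      have q: "(1 + (1 / s)\<^sup>2) * s\<^sup>2 = 1 + s\<^sup>2" "(1 + (t / s)\<^sup>2) * s\<^sup>2 = s\<^sup>2 + t\<^sup>2"
        using t by (simp_all add: power_divide distrib_right)
      have "((ln t)\<^sup>2 / (1 + (1 / s)\<^sup>2) + (- ln t)\<^sup>2 / (1 + (t / s)\<^sup>2)) / s\<^sup>2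
          = (ln t)\<^sup>2 / ((1 + (1 / s)\<^sup>2) * s\<^sup>2) + (ln t)\<^sup>2 / ((1 + (t / s)\<^sup>2) * s\<^sup>2)"
        by (simp add: add_divide_distrib)
      also have "\<dots> = (ln t)\<^sup>2 / (s\<^sup>2 + t\<^sup>2) + (ln t)\<^sup>2 / (1 + s\<^sup>2)" unfolding q by simp
      finally show "((ln (1 - 1 / (1 + t)) - ln (1 / (1 + t)))\<^sup>2 / (1 + (1 / (1 + t))\<^sup>2) +
          (ln (1 - t / (1 + t)) - ln (t / (1 + t)))\<^sup>2 / (1 + (t / (1 + t))\<^sup>2)) / (1 + t)\<^sup>2 =
          (ln t)\<^sup>2 / ((1 + t)\<^sup>2 + t\<^sup>2) + (ln t)\<^sup>2 / (1 + (1 + t)\<^sup>2)"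
        unfolding s_def[symmetric] r l .
    qed
    ultimately have "2 * Im (f (-1 + \<i>)) + 1/2 * (2 * Im (f (1 / (-1 + \<i>))) / Im (1 / (-1 + \<i>)))
        = M + pi ^ 3 / 16 + (-2) * a"
      by (rule has_abs_integral_unique)
    moreover have "Im (1 / (-1 + \<i>)) = - (1/2)" unfolding inv2 by simp
    ultimately show ?thesis by simp
  qed
  note vals = Im_polylog_3_inversion_values[OF f]
  have "v = ln 2 * pi / 8" using v by simp
  hence v': "ln 2 * v = pi * (ln 2)\<^sup>2 / 8" by (simp add: power2_eq_square)
  \<comment> \<open>The inversion value at 1 + \<i> gives \<open>M\<close> in terms of Im f(1 +
    \<i>). Then \<open>Ep\<close> with the value at -1 + \<i> gives \<open>a\<close>, and
    eliminating \<open>P\<close> between \<open>M\<close> and \<open>W\<close> gives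
    \<open>b\<close>.\<close>
  have "2 * a - 2 * b = pi / 2 * (ln 2)\<^sup>2 + pi ^ 3 / 4 + 4 * catalan * ln 2 - 8 * Im (f (1 + \<i>))"
    using M W Ep vals v' unfolding M_def by (simp add: algebra_simps)
  with lm lp show ?thesis by blast
qed

subsection \<open>Digamma differences\<close>

text \<open>\<open>dgap k = \<Sum>j. (-1)^j / (2*(k + j) + 1) = \<integral> t^(2*k) / (1 + t^2)\<close> over \<open>(0, 1)\<close>.\<close>

definition dgap :: "nat \<Rightarrow> real"
  where "dgap k = (Digamma ((2 * real k + 3) / 4) - Digamma ((2 * real k + 1) / 4)) / 4"

lemma dgap_nonneg: "dgap k \<ge> 0"
  unfolding dgap_def using Digamma_real_mono[of "(2 * real k + 1) / 4" "(2 * real k + 3) / 4"]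
  by (simp add: divide_right_mono)

text \<open>The arguments advance by 1/2, so two of the four digamma values cancel and the other two
  are one step of the functional equation apart.\<close>

lemma dgap_add_Suc: "dgap k + dgap (Suc k) = 1 / (2 * real k + 1)"
proof -
  have "(2 * real (Suc k) + 3) / 4 = (2 * real k + 1) / 4 + 1" by (simp add: field_simps)
  hence "Digamma ((2 * real (Suc k) + 3) / 4) = Digamma ((2 * real k + 1) / 4) + 1 / ((2 * real k + 1) / 4)"
    by (simp only: ) (rule Digamma_plus1, simp)
  moreover have "(2 * real (Suc k) + 1) / 4 = (2 * real k + 3) / 4" by (simp add: field_simps)
  ultimately show ?thesis unfolding dgap_def by (simp add: field_simps)
qed

lemma dgap_le: "dgap k \<le> 1 / (2 * real k + 1)"
  using dgap_add_Suc[of k] dgap_nonneg[of "Suc k"] by linarith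

lemma dgap_le_1: "dgap k \<le> 1"
proof -
  have "1 / (2 * real k + 1) \<le> 1" by simp
  thus ?thesis using dgap_le[of k] by linarith
qed

text \<open>Alternating iteration of \<open>dgap_add_Suc\<close> yields the partial sums of the
  Leibniz series for pi / 4, with remainder (-1)^n \<open>dgap n\<close> tending to 0.\<close>

lemma dgap_0: "dgap 0 = pi / 4"
proof -
  have partial: "(\<Sum>k<n. (-1) ^ k / (2 * real k + 1)) = dgap 0 - (-1) ^ n * dgap n" for n
  proof (induction n)
    case (Suc n)
    have "1 / (2 * real n + 1) = dgap n + dgap (Suc n)" by (simp add: dgap_add_Suc)
    hence "(-1) ^ n / (2 * real n + 1) = (-1) ^ n * (dgap n + dgap (Suc n))"
      by (metis mult.right_neutral times_divide_eq_right)
    thus ?case using Suc by (simp add: algebra_simps)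
  qed simp
  have "\<forall>\<^sub>F k in sequentially. 0 \<le> dgap k" "\<forall>\<^sub>F k in sequentially. dgap k \<le> 1 / (2 * real k + 1)"
    by (intro always_eventually allI dgap_nonneg dgap_le)+
  moreover have "(\<lambda>k. 1 / (2 * real k + 1)) \<longlonglongrightarrow> 0" by real_asymp
  ultimately have "dgap \<longlonglongrightarrow> 0"
    by (rule tendsto_sandwich[OF _ _ tendsto_const])
  hence "(\<lambda>n. \<bar>(-1) ^ n * dgap n\<bar>) \<longlonglongrightarrow> 0"
    by (simp add: abs_mult power_abs abs_of_nonneg[OF dgap_nonneg])
  hence "(\<lambda>n. (-1) ^ n * dgap n) \<longlonglongrightarrow> 0" by (rule tendsto_rabs_zero_cancel)
  hence "(\<lambda>n. dgap 0 - (-1) ^ n * dgap n) \<longlonglongrightarrow> dgap 0 - 0" by (intro tendsto_intros)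
  hence "(\<lambda>k. (-1) ^ k / (2 * real k + 1)) sums dgap 0"
    unfolding sums_def partial by simp
  thus ?thesis using pi_series by (simp add: sums_iff mult_ac add_ac)
qed

text \<open>This is Theta(m - 1) of the overview; the shifted index gives the formal value at -1 a
  natural number argument.\<close>

definition shifted_sum :: "nat \<Rightarrow> real"
  where "shifted_sum m = (\<Sum>i. dgap (m + Suc i) / (real (Suc i))\<^sup>2)"

lemma Theta1_eq_shifted_sum: "Theta1 n = shifted_sum (Suc n)"
  unfolding Theta1_def shifted_sum_def Let_def
proof (rule suminf_cong)
  fix i
  have "(2 * real (Suc i) + 2 * real n + 5) / 4 = (2 * real (Suc n + Suc i) + 3) / 4"
       "(2 * real (Suc i) + 2 * real n + 3) / 4 = (2 * real (Suc n + Suc i) + 1) / 4" by simp_all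
  thus "(Digamma ((2 * real (Suc i) + 2 * real n + 5) / 4) - Digamma ((2 * real (Suc i) + 2 * real n + 3) / 4)) /
      (2 * real (Suc i))\<^sup>2 = dgap (Suc n + Suc i) / (real (Suc i))\<^sup>2"
    unfolding dgap_def power_mult_distrib by (simp add: add_ac)
qed

lemma summable_dgap: "summable (\<lambda>i. dgap (m + Suc i) / (real (Suc i))\<^sup>2)"
proof (rule summable_comparison_test')
  show "summable (\<lambda>i. 1 / (real (Suc i))\<^sup>2)" using inverse_squares_sums by (simp add: sums_iff add_ac)
  fix i :: nat
  show "norm (dgap (m + Suc i) / (real (Suc i))\<^sup>2) \<le> 1 / (real (Suc i))\<^sup>2"
    using dgap_nonneg[of "m + Suc i"] dgap_le_1[of "m + Suc i"]
    by (simp add: abs_divide divide_right_mono del: of_nat_Suc)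
qed

text \<open>By \<open>dgap_add_Suc\<close> the combined summand is 1 / (k^2 (2k + c)) with c = 2m +
  1. Partial fractions split it into zeta(2) and the digamma series at m + 3/2, whose half-integer
  value brings in the finite sum and ln 2.\<close>

lemma shifted_sum_add_Suc:
  "shifted_sum m + shifted_sum (Suc m) = pi\<^sup>2 / (6 * (2 * real m + 1))
     - 2 / (2 * real m + 1)\<^sup>2 * ((\<Sum>k<Suc m. 2 / (2 * real k + 1)) - 2 * ln 2)"
proof -
  define c where "c = 2 * real m + 1"
  have c: "c > 0" by (simp add: c_def)
  have z: "(\<lambda>i. 1 / (real (Suc i))\<^sup>2) sums (pi\<^sup>2 / 6)" using inverse_squares_sums by (simp add: add_ac)
  have arg: "1 + c / 2 = real (Suc m) + 1/2" by (simp add: c_def field_simps)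
  have "(\<lambda>i. inverse (real (Suc i)) - inverse (1 + c / 2 + real i)) sums
          (Digamma (1 + c / 2) + euler_mascheroni)"
    using summable_sums[OF summable_Digamma[of "1 + c / 2"]] c by (simp add: Digamma_def)
  also have "Digamma (1 + c / 2) + euler_mascheroni = (\<Sum>k<Suc m. 2 / (2 * real k + 1)) - 2 * ln 2"
    unfolding arg using Digamma_half_integer[of "Suc m", where 'a = real] by (simp add: add_ac)
  finally have d: "(\<lambda>i. inverse (real (Suc i)) - inverse (1 + c / 2 + real i)) sums
      ((\<Sum>k<Suc m. 2 / (2 * real k + 1)) - 2 * ln 2)" .
  have "shifted_sum m + shifted_sum (Suc m) =
      (\<Sum>i. dgap (m + Suc i) / (real (Suc i))\<^sup>2 + dgap (Suc m + Suc i) / (real (Suc i))\<^sup>2)"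
    unfolding shifted_sum_def by (rule suminf_add[OF summable_dgap summable_dgap])
  also have "\<dots> = (\<Sum>i. 1 / c * (1 / (real (Suc i))\<^sup>2)
      - 2 / c\<^sup>2 * (inverse (real (Suc i)) - inverse (1 + c / 2 + real i)))"
  proof (rule suminf_cong)
    fix i
    define k where "k = real (Suc i)"
    have k: "k > 0" by (simp add: k_def)
    have "dgap (m + Suc i) + dgap (Suc (m + Suc i)) = 1 / (2 * k + c)"
      unfolding dgap_add_Suc by (simp add: k_def c_def)
    hence "dgap (m + Suc i) / k\<^sup>2 + dgap (Suc m + Suc i) / k\<^sup>2 = 1 / (2 * k + c) / k\<^sup>2"
      by (simp flip: add_divide_distrib)
    also have "\<dots> = 1 / c * (1 / k\<^sup>2) - 2 / c\<^sup>2 * (inverse k - inverse (c / 2 + k))"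
      using c k by (simp add: divide_simps power2_eq_square)
    also have "c / 2 + k = 1 + c / 2 + real i" by (simp add: k_def)
    finally show "dgap (m + Suc i) / (real (Suc i))\<^sup>2 + dgap (Suc m + Suc i) / (real (Suc i))\<^sup>2
       = 1 / c * (1 / (real (Suc i))\<^sup>2) - 2 / c\<^sup>2 * (inverse (real (Suc i)) - inverse (1 + c / 2 + real i))"
      unfolding k_def .
  qed
  also have "\<dots> = 1 / c * (pi\<^sup>2 / 6) - 2 / c\<^sup>2 * ((\<Sum>k<Suc m. 2 / (2 * real k + 1)) - 2 * ln 2)"
    by (rule sums_unique[symmetric]) (intro sums_diff sums_mult z d)
  finally show ?thesis by (simp add: c_def)
qed

text \<open>Multiplying the generating function by 1 + v^2 merges neighbouring coefficients into 1 /
  (2k + 1), that is, into the odd logarithmic series without its first term. The boundary term uses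
  \<open>dgap 1\<close> = 1 - pi / 4.\<close>

lemma dgap_power_series:
  assumes v: "v \<in> {0<..<1}"
  shows "(\<lambda>k. dgap (Suc k) * v ^ (2 * k + 1)) sums
    (((ln (1 + v) - ln (1 - v)) / 2 - pi / 4 * v) / (1 + v\<^sup>2))"
    and "summable (\<lambda>k. \<bar>dgap (Suc k)\<bar> * v ^ (2 * k + 1))"
proof -
  show sm: "summable (\<lambda>k. \<bar>dgap (Suc k)\<bar> * v ^ (2 * k + 1))"
  proof (rule summable_comparison_test')
    have "v\<^sup>2 < 1" using v by (simp add: power_less_one_iff abs_square_less_1)
    hence "summable (\<lambda>k. v * (v\<^sup>2) ^ k)" by (intro summable_mult summable_geometric) simp
    thus "summable (\<lambda>k. v ^ (2 * k + 1))" by (simp add: power_mult)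
    fix k :: nat
    show "norm (\<bar>dgap (Suc k)\<bar> * v ^ (2 * k + 1)) \<le> v ^ (2 * k + 1)"
      using v dgap_nonneg[of "Suc k"] dgap_le_1[of "Suc k"]
      by (simp add: abs_mult power_abs mult_left_le_one_le)
  qed
  define B where "B = (\<Sum>k. dgap (Suc k) * v ^ (2 * k + 1))"
  have B: "(\<lambda>k. dgap (Suc k) * v ^ (2 * k + 1)) sums B"
    using sm by (simp add: B_def abs_of_nonneg[OF dgap_nonneg] summable_sums)
  have "(\<lambda>k. dgap (Suc (Suc k)) * v ^ (2 * Suc k + 1)) sums (B - dgap 1 * v)"
    using B by (subst sums_Suc_iff) simp
  moreover have "(\<lambda>k. v\<^sup>2 * (dgap (Suc k) * v ^ (2 * k + 1))) sums (v\<^sup>2 * B)"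
    by (rule sums_mult[OF B])
  ultimately have "(\<lambda>k. dgap (Suc (Suc k)) * v ^ (2 * Suc k + 1) + v\<^sup>2 * (dgap (Suc k) * v ^ (2 * k + 1)))
      sums (B - dgap 1 * v + v\<^sup>2 * B)" by (rule sums_add)
  moreover have "dgap (Suc (Suc k)) * v ^ (2 * Suc k + 1) + v\<^sup>2 * (dgap (Suc k) * v ^ (2 * k + 1))
      = v ^ (2 * Suc k + 1) / (2 * real (Suc k) + 1)" for k
  proof -
    have "dgap (Suc (Suc k)) * v ^ (2 * Suc k + 1) + v\<^sup>2 * (dgap (Suc k) * v ^ (2 * k + 1))
        = (dgap (Suc k) + dgap (Suc (Suc k))) * v ^ (2 * Suc k + 1)"
      by (simp add: power2_eq_square algebra_simps)
    thus ?thesis unfolding dgap_add_Suc by simp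
  qed
  ultimately have s1: "(\<lambda>k. v ^ (2 * Suc k + 1) / (2 * real (Suc k) + 1)) sums (B - dgap 1 * v + v\<^sup>2 * B)"
    by simp
  have "(1 + v) / (1 - v) > 0" using v by simp
  from ln_series_quadratic[OF this]
  have "(\<lambda>n. 2 * (((1 + v) / (1 - v) - 1) / ((1 + v) / (1 - v) + 1)) ^ (2 * n + 1) / real (2 * n + 1)) sums
      ln ((1 + v) / (1 - v))" by simp
  moreover have "((1 + v) / (1 - v) - 1) / ((1 + v) / (1 - v) + 1) = v" using v by (simp add: field_simps)
  ultimately have "(\<lambda>n. 1/2 * (2 * v ^ (2 * n + 1) / real (2 * n + 1))) sums (1/2 * ln ((1 + v) / (1 - v)))"
    by (intro sums_mult) simp
  hence "(\<lambda>n. v ^ (2 * n + 1) / (2 * real n + 1)) sums ((ln (1 + v) - ln (1 - v)) / 2)"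
    using v by (simp add: ln_div add_ac)
  hence "(\<lambda>n. v ^ (2 * Suc n + 1) / (2 * real (Suc n) + 1)) sums ((ln (1 + v) - ln (1 - v)) / 2 - v)"
    by (subst sums_Suc_iff) simp
  with s1 have eq: "B - dgap 1 * v + v\<^sup>2 * B = (ln (1 + v) - ln (1 - v)) / 2 - v" by (rule sums_unique2)
  have d1: "dgap 1 = 1 - pi / 4" using dgap_add_Suc[of 0] dgap_0 by simp
  have "B * (1 + v\<^sup>2) = (ln (1 + v) - ln (1 - v)) / 2 - pi / 4 * v"
    using eq[unfolded d1] by (simp add: algebra_simps)
  moreover have "1 + v\<^sup>2 \<noteq> 0" using zero_le_power2[of v] by linarith
  ultimately have "B = ((ln (1 + v) - ln (1 - v)) / 2 - pi / 4 * v) / (1 + v\<^sup>2)"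
    by (simp add: eq_divide_eq)
  with B show "(\<lambda>k. dgap (Suc k) * v ^ (2 * k + 1)) sums
    (((ln (1 + v) - ln (1 - v)) / 2 - pi / 4 * v) / (1 + v\<^sup>2))" by simp
qed

text \<open>Against - ln v the power v^(2k + 1) integrates to 1 / (4 (k + 1)^2), so the generating
  function produces a quarter of this sum.\<close>

lemma shifted_sum_0:
  "shifted_sum 0 = pi / 2 * (ln 2)\<^sup>2 + 11 * pi ^ 3 / 48 + 4 * catalan * ln 2 - 8 * Im (Li3 (1 + \<i>))"
proof -
  obtain f where f: "is_polylog 3 f" using is_polylog_exists by blast
  obtain a b where a: "has_arctan_integral (\<lambda>t. ln t * ln (1 - t)) a"
    and b: "has_arctan_integral (\<lambda>t. ln t * ln (1 + t)) b"
    and ab: "2 * a - 2 * b = pi / 2 * (ln 2)\<^sup>2 + pi ^ 3 / 4 + 4 * catalan * ln 2 - 8 * Im (f (1 + \<i>))"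
    using arctan_integral_log_products[OF f] by blast
  have quarter: "dgap (Suc k) / (real (2 * k + 1) + 1)\<^sup>2 = 1/4 * (dgap (0 + Suc k) / (real (Suc k))\<^sup>2)" for k
  proof -
    have "(real (2 * k + 1) + 1)\<^sup>2 = 4 * (real (Suc k))\<^sup>2" by (simp add: power2_eq_square algebra_simps)
    thus ?thesis by simp
  qed
  \<comment> \<open>Needed for the term - pi/4 v of the generating function, which contributes -
    pi^3 / 48 after multiplication by 4.\<close>
  have t: "has_arctan_integral (\<lambda>t. - ln t * t) (pi\<^sup>2 / 48)"
  proof -
    have "has_abs_integral (\<lambda>t. - ln t * (t ^ 1 / (1 + t ^ 2))) {0<..<1} (\<Sum>k. (-1) ^ k / (real (2 * k + 1) + 1)\<^sup>2)"
      by (rule has_abs_integral_ln_over_one_plus_power) simp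
    also have "(\<Sum>k. (-1) ^ k / (real (2 * k + 1) + 1)\<^sup>2) = (\<Sum>k. 1/4 * ((-1) ^ k / (real k + 1)\<^sup>2))"
    proof (rule suminf_cong)
      fix k :: nat
      have "(real (2 * k + 1) + 1)\<^sup>2 = 4 * (real k + 1)\<^sup>2" by (simp add: power2_eq_square algebra_simps)
      thus "(-1) ^ k / (real (2 * k + 1) + 1)\<^sup>2 = 1/4 * ((-1) ^ k / (real k + 1)\<^sup>2)" by simp
    qed
    also have "\<dots> = 1/4 * (\<Sum>k. (-1) ^ k / (real k + 1)\<^sup>2)"
    proof (rule suminf_mult)
      have "summable (\<lambda>k. 1 / (real k + 1)\<^sup>2)" using inverse_squares_sums by (simp add: sums_iff add_ac)
      thus "summable (\<lambda>k. (-1) ^ k / (real k + 1)\<^sup>2)"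
        by (rule summable_comparison_test') (simp add: power_abs)
    qed
    finally show ?thesis by (simp add: has_arctan_integral_def alternating_inverse_squares_sum)
  qed
  have "has_abs_integral (\<lambda>v. - ln v * (((ln (1 + v) - ln (1 - v)) / 2 - pi / 4 * v) / (1 + v\<^sup>2))) {0<..<1}
      (\<Sum>k. dgap (Suc k) / (real (2 * k + 1) + 1)\<^sup>2)"
  proof (rule has_abs_integral_ln_power_series)
    have "\<bar>dgap (Suc k)\<bar> / (real (2 * k + 1) + 1)\<^sup>2 = 1/4 * (dgap (0 + Suc k) / (real (Suc k))\<^sup>2)" for k
      using quarter[of k] by (simp only: abs_of_nonneg[OF dgap_nonneg])
    thus "summable (\<lambda>k. \<bar>dgap (Suc k)\<bar> / (real (2 * k + 1) + 1)\<^sup>2)"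
      using summable_mult[OF summable_dgap[of 0], of "1/4"] by (simp only:)
  qed (fact dgap_power_series)+
  moreover have "(\<Sum>k. dgap (Suc k) / (real (2 * k + 1) + 1)\<^sup>2) = 1/4 * shifted_sum 0"
    unfolding quarter shifted_sum_def by (rule suminf_mult[OF summable_dgap])
  ultimately have "has_arctan_integral (\<lambda>v. - ln v * ((ln (1 + v) - ln (1 - v)) / 2 - pi / 4 * v)) (1/4 * shifted_sum 0)"
    unfolding has_arctan_integral_def by (simp only: times_divide_eq_right)
  moreover have "has_arctan_integral (\<lambda>v. 1/2 * (ln v * ln (1 - v)) + (-1/2) * (ln v * ln (1 + v)) + (- pi / 4) * (- ln v * v))
     (1/2 * a + (-1/2) * b + (- pi / 4) * (pi\<^sup>2 / 48))"
    by (intro has_arctan_integral_add has_arctan_integral_cmult a b t)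
  moreover have "(\<lambda>v. 1/2 * (ln v * ln (1 - v)) + (-1/2) * (ln v * ln (1 + v)) + (- pi / 4) * (- ln v * v))
      = (\<lambda>v. - ln v * ((ln (1 + v) - ln (1 - v)) / 2 - pi / 4 * v))"
    by (rule ext) (simp add: field_simps)
  ultimately have "1/4 * shifted_sum 0 = 1/2 * a + (-1/2) * b + (- pi / 4) * (pi\<^sup>2 / 48)"
    using has_arctan_integral_unique by (simp only:)
  hence "shifted_sum 0 = 2 * a - 2 * b - pi ^ 3 / 48" by (simp add: power2_eq_square power3_eq_cube)
  thus ?thesis using ab Li3_eq_polylog[OF f one_plus_i_in_cut_plane] by simp
qed

subsection \<open>Recurrence in \<open>n\<close>\<close>

text \<open>Converts the half-integer digamma sum to harmonic numbers: the odd denominators are all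
  denominators up to 2m + 1 minus the even ones, which sum to half of \<open>harm m\<close>.\<close>

lemma sum_odd_reciprocals:
  "(\<Sum>k<Suc m. 2 / (2 * real k + 1)) = 2 * harm (2 * m + 1) - harm m"
proof (induction m)
  case 0
  show ?case by (simp add: harm_def)
next
  case (Suc m)
  have "2 * inverse (real (Suc (Suc (2 * m)))) = inverse (real (Suc m))"
    by (simp add: inverse_eq_divide divide_simps)
  moreover have "2 * inverse (real (Suc (Suc (Suc (2 * m))))) = 2 / (2 * real (Suc m) + 1)"
    by (simp add: inverse_eq_divide)
  moreover have "harm (2 * Suc m + 1) = harm (2 * m + 1) + inverse (real (Suc (Suc (2 * m))))
      + inverse (real (Suc (Suc (Suc (2 * m)))))"
    by (simp add: harm_Suc del: of_nat_Suc)
  moreover have "harm (Suc m) = harm m + inverse (real (Suc m))" by (rule harm_Suc)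
  ultimately show ?case unfolding sum.lessThan_Suc[of _ "Suc m"] Suc.IH by (simp only:) (simp add: algebra_simps)
qed

text \<open>The difference of two consecutive instances of \<open>shifted_sum_add_Suc\<close>, in
  which the middle sum cancels. The second finite sum has the extra term 2 / y, the source of 4 /
  y^3.\<close>

lemma Theta1_add_2:
  assumes x: "x = 2 * real n + 3" and y: "y = 2 * real n + 5"
  shows "Theta1 (n + 2) = Theta1 n - pi\<^sup>2 / (3 * (y * x)) - 4 / y ^ 3
    + 8 * (x + 1) * ((\<Sum>k<n + 2. 2 / (2 * real k + 1)) - 2 * ln 2) / (y\<^sup>2 * x\<^sup>2)"
proof -
  define S where "S = (\<Sum>k<n + 2. 2 / (2 * real k + 1)) - 2 * ln 2"
  have pos: "x > 0" "y > 0" and yx: "y = x + 2" by (simp_all add: x y)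
  have "shifted_sum (Suc n) + shifted_sum (n + 2) = pi\<^sup>2 / (6 * x) - 2 / x\<^sup>2 * S"
    using shifted_sum_add_Suc[of "Suc n"] by (simp add: x S_def add_ac)
  moreover have "shifted_sum (n + 2) + shifted_sum (n + 3) = pi\<^sup>2 / (6 * y) - (2 / y\<^sup>2 * S + 2 / y\<^sup>2 * (2 / y))"
    unfolding distrib_left[symmetric]
    using shifted_sum_add_Suc[of "n + 2"] by (simp add: y S_def add_ac eval_nat_numeral)
  ultimately have "shifted_sum (n + 3) = shifted_sum (Suc n)
      + (pi\<^sup>2 / (6 * y) - pi\<^sup>2 / (6 * x)) - 2 / y\<^sup>2 * (2 / y) + (2 / x\<^sup>2 * S - 2 / y\<^sup>2 * S)"
    by linarith
  also have "pi\<^sup>2 / (6 * y) - pi\<^sup>2 / (6 * x) = - (pi\<^sup>2 / (3 * (y * x)))"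
    using pos by (simp add: divide_simps) (simp add: yx algebra_simps)
  also have "2 / y\<^sup>2 * (2 / y) = 4 / y ^ 3" by (simp add: power2_eq_square power3_eq_cube)
  also have "2 / x\<^sup>2 * S - 2 / y\<^sup>2 * S = (2 / x\<^sup>2 - 2 / y\<^sup>2) * S" by (rule left_diff_distrib[symmetric])
  also have "2 / x\<^sup>2 - 2 / y\<^sup>2 = 8 * (x + 1) / (y\<^sup>2 * x\<^sup>2)"
    using pos by (simp add: divide_simps) (simp add: yx power2_eq_square algebra_simps)
  finally show ?thesis by (simp add: Theta1_eq_shifted_sum S_def eval_nat_numeral)
qed

text \<open>Each use of \<open>shifted_sum_add_Suc\<close> reverses the sign of the part inherited
  from \<open>shifted_sum_0\<close>; hence the opposite signs in the even and odd cases.\<close>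

lemma Theta1_0:
  "Theta1 0 = - 4 + 4 * ln 2 - pi / 2 * (ln 2)\<^sup>2 + pi\<^sup>2 / 6 - 11 * pi ^ 3 / 48
     - 4 * catalan * ln 2 + 8 * Im (Li3 (1 + \<i>))"
  using shifted_sum_add_Suc[of 0] shifted_sum_0 by (simp add: Theta1_eq_shifted_sum)

lemma Theta1_1:
  "Theta1 1 = 92 / 27 - pi\<^sup>2 / 9 - 32 * ln 2 / 9 + pi / 2 * (ln 2)\<^sup>2 + 11 * pi ^ 3 / 48
     + 4 * catalan * ln 2 - 8 * Im (Li3 (1 + \<i>))"
  using shifted_sum_add_Suc[of 1] Theta1_0
  by (simp add: Theta1_eq_shifted_sum eval_nat_numeral field_simps)

lemma Theta1_even:
  "Theta1 (2 * m) = - 4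
     + 32 * (\<Sum>j<m. (real j + 1) * (2 * harm (4 * j + 3) - harm (2 * j + 1))
         / ((4 * real j + 5)\<^sup>2 * (4 * real j + 3)\<^sup>2))
     - 4 * (\<Sum>j<m. 1 / (4 * real j + 5) ^ 3)
     + pi\<^sup>2 * (1 / 6 - 1 / 3 * (\<Sum>j<m. 1 / ((4 * real j + 5) * (4 * real j + 3))))
     + ln 2 * (4 - 64 * (\<Sum>j<m. (real j + 1) / ((4 * real j + 5)\<^sup>2 * (4 * real j + 3)\<^sup>2)))
     - pi / 2 * (ln 2)\<^sup>2 - 11 * pi ^ 3 / 48 - 4 * catalan * ln 2 + 8 * Im (Li3 (1 + \<i>))"
proof (induction m)
  case 0
  show ?case using Theta1_0 by simp
next
  case (Suc j)
  define h :: real where "h = 2 * harm (4 * j + 3) - harm (2 * j + 1)"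
  define d where "d = (4 * real j + 5)\<^sup>2 * (4 * real j + 3)\<^sup>2"
  define e where "e = (4 * real j + 5) * (4 * real j + 3)"
  have "2 * (2 * j + 1) + 1 = 4 * j + 3" "Suc (2 * j + 1) = 2 * j + 2" by simp_all
  note S = sum_odd_reciprocals[of "2 * j + 1", unfolded this, folded h_def]
  have "4 * real j + 3 = 2 * real (2 * j) + 3" "4 * real j + 5 = 2 * real (2 * j) + 5" by simp_all
  from Theta1_add_2[OF this, unfolded S, folded d_def e_def]
  have "Theta1 (2 * Suc j) = Theta1 (2 * j) - pi\<^sup>2 / (3 * e) - 4 / (4 * real j + 5) ^ 3
    + 8 * (4 * real j + 3 + 1) * (h - 2 * ln 2) / d" by simp
  \<comment> \<open>Here 8 (x + 1) = 32 (j + 1), and the factor 2 in front of ln 2 doubles this to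
    64.\<close>
  also have "\<dots> = Theta1 (2 * j) + 32 * ((real j + 1) * h / d) - 4 * (1 / (4 * real j + 5) ^ 3)
    - pi\<^sup>2 * (1 / 3 * (1 / e)) - ln 2 * (64 * ((real j + 1) / d))"
    by (simp add: add_divide_distrib diff_divide_distrib algebra_simps)
  finally show ?case unfolding Suc.IH sum.lessThan_Suc h_def d_def e_def
    by (simp only: distrib_left right_diff_distrib)
qed

text \<open>The base value is Theta(1), so the sums start at j = 1: the step from 2m + 1 to 2m + 3
  has j = m + 1, x = 4j + 1 and y = 4j + 3, and 8 (x + 1) = 16 (2j + 1).\<close>

lemma Theta1_odd:
  "Theta1 (2 * m + 1) = 92 / 27
     + 16 * (\<Sum>j = 1..m. (2 * real j + 1) * (2 * harm (4 * j + 1) - harm (2 * j))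
         / ((4 * real j + 3)\<^sup>2 * (4 * real j + 1)\<^sup>2))
     - 4 * (\<Sum>j = 1..m. 1 / (4 * real j + 3) ^ 3)
     - pi\<^sup>2 * (1 / 9 + 1 / 3 * (\<Sum>j = 1..m. 1 / ((4 * real j + 3) * (4 * real j + 1))))
     - ln 2 * (32 / 9 + 32 * (\<Sum>j = 1..m. (2 * real j + 1) / ((4 * real j + 3)\<^sup>2 * (4 * real j + 1)\<^sup>2)))
     + pi / 2 * (ln 2)\<^sup>2 + 11 * pi ^ 3 / 48 + 4 * catalan * ln 2 - 8 * Im (Li3 (1 + \<i>))"
proof (induction m)
  case 0
  show ?case using Theta1_1 by simp
next
  case (Suc m)
  define j where "j = Suc m"
  define h :: real where "h = 2 * harm (4 * j + 1) - harm (2 * j)"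
  define d where "d = (4 * real j + 3)\<^sup>2 * (4 * real j + 1)\<^sup>2"
  define e where "e = (4 * real j + 3) * (4 * real j + 1)"
  have "2 * (2 * j) + 1 = 4 * j + 1" "Suc (2 * j) = 2 * m + 1 + 2" by (simp_all add: j_def)
  note S = sum_odd_reciprocals[of "2 * j", unfolded this, folded h_def]
  have "4 * real j + 1 = 2 * real (2 * m + 1) + 3" "4 * real j + 3 = 2 * real (2 * m + 1) + 5"
    by (simp_all add: j_def)
  from Theta1_add_2[OF this, unfolded S, folded d_def e_def]
  have "Theta1 (2 * Suc m + 1) = Theta1 (2 * m + 1) - pi\<^sup>2 / (3 * e) - 4 / (4 * real j + 3) ^ 3
    + 8 * (4 * real j + 1 + 1) * (h - 2 * ln 2) / d" by simp
  also have "\<dots> = Theta1 (2 * m + 1) + 16 * ((2 * real j + 1) * h / d) - 4 * (1 / (4 * real j + 3) ^ 3)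
    - pi\<^sup>2 * (1 / 3 * (1 / e)) - ln 2 * (32 * ((2 * real j + 1) / d))"
    by (simp add: add_divide_distrib diff_divide_distrib algebra_simps)
  finally have "Theta1 (2 * Suc m + 1) = Theta1 (2 * m + 1) + 16 * ((2 * real j + 1) * h / d) - 4 * (1 / (4 * real j + 3) ^ 3)
    - pi\<^sup>2 * (1 / 3 * (1 / e)) - ln 2 * (32 * ((2 * real j + 1) / d))" .
  moreover have split: "sum g {1..Suc m} = sum g {1..m} + g j" for g :: "nat \<Rightarrow> real"
    by (simp add: j_def)
  ultimately show ?case unfolding Suc.IH split h_def d_def e_def
    by (simp only: distrib_left right_diff_distrib)
qed

theorem theorem6:
  fixes n :: nat
  shows
    "(n = 0 \<longrightarrow>
        Theta1 0 = - 4 + 4 * ln 2 - pi / 2 * (ln 2)\<^sup>2 + pi\<^sup>2 / 6 - 11 * pi ^ 3 / 48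
          - 4 * catalan * ln 2 + 8 * Im (Li3 (1 + \<i>))) \<and>
     (n = 1 \<longrightarrow>
        Theta1 1 = 92 / 27 - pi\<^sup>2 / 9 - 32 * ln 2 / 9 + pi / 2 * (ln 2)\<^sup>2 + 11 * pi ^ 3 / 48
          + 4 * catalan * ln 2 - 8 * Im (Li3 (1 + \<i>))) \<and>
     (odd n \<and> n \<noteq> 1 \<longrightarrow>
        Theta1 n = 92 / 27
          + 16 * (\<Sum>j = 1..(n - 1) div 2.
              (2 * real j + 1) * (2 * harm (4 * j + 1) - harm (2 * j))
                / ((4 * real j + 3)\<^sup>2 * (4 * real j + 1)\<^sup>2))
          - 4 * (\<Sum>j = 1..(n - 1) div 2. 1 / (4 * real j + 3) ^ 3)
          - pi\<^sup>2 * (1 / 9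
              + 1 / 3 * (\<Sum>j = 1..(n - 1) div 2. 1 / ((4 * real j + 3) * (4 * real j + 1))))
          - ln 2 * (32 / 9
              + 32 * (\<Sum>j = 1..(n - 1) div 2.
                  (2 * real j + 1) / ((4 * real j + 3)\<^sup>2 * (4 * real j + 1)\<^sup>2)))
          + pi / 2 * (ln 2)\<^sup>2 + 11 * pi ^ 3 / 48
          + 4 * catalan * ln 2 - 8 * Im (Li3 (1 + \<i>))) \<and>
     (even n \<longrightarrow>
        Theta1 n = - 4
          + 32 * (\<Sum>j<n div 2.
              (real j + 1) * (2 * harm (4 * j + 3) - harm (2 * j + 1))
                / ((4 * real j + 5)\<^sup>2 * (4 * real j + 3)\<^sup>2))
          - 4 * (\<Sum>j<n div 2. 1 / (4 * real j + 5) ^ 3)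
          + pi\<^sup>2 * (1 / 6
              - 1 / 3 * (\<Sum>j<n div 2. 1 / ((4 * real j + 5) * (4 * real j + 3))))
          + ln 2 * (4
              - 64 * (\<Sum>j<n div 2.
                  (real j + 1) / ((4 * real j + 5)\<^sup>2 * (4 * real j + 3)\<^sup>2)))
          - pi / 2 * (ln 2)\<^sup>2 - 11 * pi ^ 3 / 48
          - 4 * catalan * ln 2 + 8 * Im (Li3 (1 + \<i>)))"
proof (intro conjI impI)
  assume "odd n \<and> n \<noteq> 1"
  then obtain m where "n = 2 * m + 1" by (blast elim: oddE)
  with Theta1_odd[of m] show "Theta1 n = 92 / 27
          + 16 * (\<Sum>j = 1..(n - 1) div 2.
              (2 * real j + 1) * (2 * harm (4 * j + 1) - harm (2 * j))
                / ((4 * real j + 3)\<^sup>2 * (4 * real j + 1)\<^sup>2))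
          - 4 * (\<Sum>j = 1..(n - 1) div 2. 1 / (4 * real j + 3) ^ 3)
          - pi\<^sup>2 * (1 / 9
              + 1 / 3 * (\<Sum>j = 1..(n - 1) div 2. 1 / ((4 * real j + 3) * (4 * real j + 1))))
          - ln 2 * (32 / 9
              + 32 * (\<Sum>j = 1..(n - 1) div 2.
                  (2 * real j + 1) / ((4 * real j + 3)\<^sup>2 * (4 * real j + 1)\<^sup>2)))
          + pi / 2 * (ln 2)\<^sup>2 + 11 * pi ^ 3 / 48
          + 4 * catalan * ln 2 - 8 * Im (Li3 (1 + \<i>))" by simp
next
  assume "even n"
  then obtain m where "n = 2 * m" by blast
  with Theta1_even[of m] show "Theta1 n = - 4
          + 32 * (\<Sum>j<n div 2.
              (real j + 1) * (2 * harm (4 * j + 3) - harm (2 * j + 1))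
                / ((4 * real j + 5)\<^sup>2 * (4 * real j + 3)\<^sup>2))
          - 4 * (\<Sum>j<n div 2. 1 / (4 * real j + 5) ^ 3)
          + pi\<^sup>2 * (1 / 6
              - 1 / 3 * (\<Sum>j<n div 2. 1 / ((4 * real j + 5) * (4 * real j + 3))))
          + ln 2 * (4
              - 64 * (\<Sum>j<n div 2.
                  (real j + 1) / ((4 * real j + 5)\<^sup>2 * (4 * real j + 3)\<^sup>2)))
          - pi / 2 * (ln 2)\<^sup>2 - 11 * pi ^ 3 / 48
          - 4 * catalan * ln 2 + 8 * Im (Li3 (1 + \<i>))" by simp
qed (rule Theta1_0 Theta1_1)+

end
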